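(* Let $(X,d)$ be a compact metric space. Then the following conditions are equivalent. (1) $(X,d)$ is quasihypermetric. (2) $\sum_{i,j=1}^n d(x_i,x_j)+\sum_{i,j=1}^n d(y_i,y_j)\le 2\sum_{i,j=1}^n d(x_i,y_j)$ for all $n\in\mathbb{N}$ and for all $x_1,\dots,x_n,y_1,\dots,y_n\in X$. (3) $I(\mu)\le 0$ for all $\mu\in\mathcal{M}_0(X)$. (4) $I(\mu,\nu)^2\le I(\mu)I(\nu)$ for all $\mu,\nu\in\mathcal{M}_0(X)$. (5) $I(\mu)+I(\nu)\le 2I(\mu,\nu)$ for all $\mu,\nu\in\mathcal{M}_1(X)$. (6) $I(\mu)+I(\nu)\le 2I(\mu,\nu)$ for all $\mu,\nu\in\mathcal{M}_1^+(X)$. (7) $\frac12\bigl(I(\mu)+I(\nu)\bigr)\le I\bigl(\frac12(\mu+\nu)\bigr)$ for all $\mu,\nu\in\mathcal{M}_1(X)$. (8) $\frac12\bigl(I(\mu)+I(\nu)\bigr)\le I\bigl(\frac12(\mu+\nu)\bigr)$ for all $\mu,\nu\in\mathcal{M}_1^+(X)$.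
   Context: A metric space $(X,d)$ is called quasihypermetric if for all $n\in\mathbb{N}$, all $\alpha_1,\dots,\alpha_n\in\mathbb{R}$ with $\sum_{i=1}^n\alpha_i=0$ and all $x_1,\dots,x_n\in X$ one has $\sum_{i,j=1}^n\alpha_i\alpha_j d(x_i,x_j)\le 0$. For a compact metric space $(X,d)$, $\mathcal{M}(X)$ is the space of all finite signed Borel measures on $X$; $\mathcal{M}_0(X)$ is the subspace of measures of total mass $0$; $\mathcal{M}_1(X)$ is the affine subspace of measures of total mass $1$; $\mathcal{M}_1^+(X)$ is the set of Borel probability measures on $X$. For $\mu,\nu\in\mathcal{M}(X)$, $I(\mu,\nu)=\int_X\int_X d(x,y)\,d\mu(x)\,d\nu(y)$ and $I(\mu)=I(\mu,\mu)$. *)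

theory Defs
  imports "HOL-Probability.Probability"
begin

text \<open>A compact metric space is given as a compact subset \<open>X\<close> of a type of class
  \<open>metric_space\<close>, with the distance inherited from that type.\<close>

definition quasihypermetric :: "'a::metric_space set \<Rightarrow> bool" where
  "quasihypermetric X \<longleftrightarrow>
    (\<forall>(n::nat) (\<alpha>::nat \<Rightarrow> real) (x::nat \<Rightarrow> 'a).
      (\<Sum>i=1..n. \<alpha> i) = 0 \<longrightarrow> (\<forall>i\<in>{1..n}. x i \<in> X) \<longrightarrow>
      (\<Sum>i=1..n. \<Sum>j=1..n. \<alpha> i * \<alpha> j * dist (x i) (x j)) \<le> 0)"

abbreviation borel_on :: "'a::topological_space set \<Rightarrow> 'a measure" where
  "borel_on X \<equiv> restrict_space borel X"

text \<open>A finite signed measure is a countably additive real-valued set function on the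
  \<open>\<sigma>\<close>-algebra of \<open>M\<close> (on which \<open>M\<close>'s own measure plays no role).  As for
  \<^const>\<open>emeasure\<close>, the value outside the \<open>\<sigma>\<close>-algebra is fixed to be 0, so that
  signed measures that agree on the \<open>\<sigma>\<close>-algebra are equal.\<close>

definition finite_signed_measure :: "'a measure \<Rightarrow> ('a set \<Rightarrow> real) \<Rightarrow> bool" where
  "finite_signed_measure M \<mu> \<longleftrightarrow>
    \<mu> {} = 0 \<and>
    (\<forall>A::nat \<Rightarrow> 'a set. range A \<subseteq> sets M \<longrightarrow> disjoint_family A \<longrightarrow>
      (\<lambda>n. \<mu> (A n)) sums \<mu> (\<Union>n. A n)) \<and>
    (\<forall>A. A \<notin> sets M \<longrightarrow> \<mu> A = 0)"

text \<open>Jordan decomposition: \<open>\<mu>\<^sup>+(A)\<close> is the supremum of \<open>\<mu>(B)\<close> over measurable \<open>B \<subseteq> A\<close>,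
  and \<open>\<mu>\<^sup>- = (-\<mu>)\<^sup>+\<close>.  The function \<^const>\<open>ennreal\<close> sends negative reals to 0, which does not
  change the supremum because \<open>B = {}\<close> is admitted.\<close>

definition upper_variation :: "'a measure \<Rightarrow> ('a set \<Rightarrow> real) \<Rightarrow> 'a measure" where
  "upper_variation M \<mu> =
    measure_of (space M) (sets M) (\<lambda>A. SUP B\<in>{B \<in> sets M. B \<subseteq> A}. ennreal (\<mu> B))"

definition lower_variation :: "'a measure \<Rightarrow> ('a set \<Rightarrow> real) \<Rightarrow> 'a measure" where
  "lower_variation M \<mu> = upper_variation M (\<lambda>A. - \<mu> A)"

definition signed_integral :: "'a measure \<Rightarrow> ('a set \<Rightarrow> real) \<Rightarrow> ('a \<Rightarrow> real) \<Rightarrow> real" where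
  "signed_integral M \<mu> f =
    integral\<^sup>L (upper_variation M \<mu>) f - integral\<^sup>L (lower_variation M \<mu>) f"

definition signed_measures :: "'a::topological_space set \<Rightarrow> ('a set \<Rightarrow> real) set" where
  "signed_measures X = {\<mu>. finite_signed_measure (borel_on X) \<mu>}"

definition signed_measures0 :: "'a::topological_space set \<Rightarrow> ('a set \<Rightarrow> real) set" where
  "signed_measures0 X = {\<mu> \<in> signed_measures X. \<mu> X = 0}"

definition signed_measures1 :: "'a::topological_space set \<Rightarrow> ('a set \<Rightarrow> real) set" where
  "signed_measures1 X = {\<mu> \<in> signed_measures X. \<mu> X = 1}"

definition probability_measures :: "'a::topological_space set \<Rightarrow> ('a set \<Rightarrow> real) set" where
  "probability_measures X = {measure P |P. prob_space P \<and> sets P = sets (borel_on X)}"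

definition mutual_energy ::
  "'a::metric_space set \<Rightarrow> ('a set \<Rightarrow> real) \<Rightarrow> ('a set \<Rightarrow> real) \<Rightarrow> real" where
  "mutual_energy X \<mu> \<nu> =
    signed_integral (borel_on X) \<nu> (\<lambda>y. signed_integral (borel_on X) \<mu> (\<lambda>x. dist x y))"

abbreviation energy :: "'a::metric_space set \<Rightarrow> ('a set \<Rightarrow> real) \<Rightarrow> real" where
  "energy X \<mu> \<equiv> mutual_energy X \<mu> \<mu>"

text \<open>Consistency with the library: the probability measures are the nonnegative elements of
  \<^const>\<open>signed_measures1\<close>, and for an ordinary finite measure \<^const>\<open>signed_integral\<close> is the
  Bochner integral.\<close>

lemma probability_measures_eq:
  "probability_measures X = {\<mu> \<in> signed_measures1 X. \<forall>A. 0 \<le> \<mu> A}"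
proof (intro equalityI subsetI)
  fix \<mu> assume "\<mu> \<in> probability_measures X"
  then obtain P where P: "prob_space P" "sets P = sets (borel_on X)" "\<mu> = measure P"
    by (auto simp: probability_measures_def)
  interpret prob_space P by fact
  have sp: "space P = X"
    using sets_eq_imp_space_eq[OF P(2)] by (simp add: space_restrict_space)
  have "finite_signed_measure (borel_on X) \<mu>"
    unfolding finite_signed_measure_def P(3) P(2)[symmetric]
    by (auto simp: measure_notin_sets intro!: finite_measure_UNION)
  then show "\<mu> \<in> {\<mu> \<in> signed_measures1 X. \<forall>A. 0 \<le> \<mu> A}"
    using prob_space sp by (auto simp: signed_measures1_def signed_measures_def P(3))
next
  fix \<mu> :: "'a set \<Rightarrow> real"
  assume asm: "\<mu> \<in> {\<mu> \<in> signed_measures1 X. \<forall>A. 0 \<le> \<mu> A}"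
  then have fs: "finite_signed_measure (borel_on X) \<mu>" and X: "\<mu> X = 1" and nn: "\<And>A. 0 \<le> \<mu> A"
    by (auto simp: signed_measures1_def signed_measures_def)
  define P where "P = measure_of (space (borel_on X)) (sets (borel_on X)) (\<lambda>A. ennreal (\<mu> A))"
  have sets: "sets P = sets (borel_on X)" and space: "space P = X"
    unfolding P_def sets.sets_measure_of_eq sets.space_measure_of_eq
    by (simp_all add: space_restrict_space)
  have em: "emeasure P A = ennreal (\<mu> A)" if "A \<in> sets P" for A
  proof (rule emeasure_measure_of[OF P_def])
    show "sets (borel_on X) \<subseteq> Pow (space (borel_on X))"
      by (rule sets.space_closed)
    show "positive (sets P) (\<lambda>A. ennreal (\<mu> A))"
      using fs by (simp add: positive_def finite_signed_measure_def)
    show "countably_additive (sets P) (\<lambda>A. ennreal (\<mu> A))"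
      unfolding sets
    proof (rule countably_additiveI)
      fix A :: "nat \<Rightarrow> 'a set"
      assume "range A \<subseteq> sets (borel_on X)" "disjoint_family A"
      then have "(\<lambda>n. \<mu> (A n)) sums \<mu> (\<Union>n. A n)"
        using fs by (auto simp: finite_signed_measure_def)
      then show "(\<Sum>i. ennreal (\<mu> (A i))) = ennreal (\<mu> (\<Union>i. A i))"
        using nn by (intro suminf_ennreal_eq) auto
    qed
  qed (fact that)
  have "prob_space P"
    by (rule prob_spaceI) (use em[OF sets.top] X in \<open>simp add: space\<close>)
  moreover have "measure P A = \<mu> A" for A
  proof (cases "A \<in> sets P")
    case True then show ?thesis using em nn by (simp add: measure_def)
  next
    case False then show ?thesis
      using fs by (simp add: measure_notin_sets sets finite_signed_measure_def)
  qed
  then have "\<mu> = measure P" by auto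
  ultimately show "\<mu> \<in> probability_measures X"
    using sets by (auto simp: probability_measures_def)
qed

lemma signed_integral_measure:
  assumes "finite_measure P" "sets P = sets M"
  shows "signed_integral M (measure P) f = integral\<^sup>L P f"
proof -
  interpret finite_measure P by fact
  have sp: "space M = space P"
    using sets_eq_imp_space_eq[OF assms(2)] by simp
  have up: "upper_variation M (measure P) = P"
  proof -
    have "upper_variation M (measure P) = measure_of (space P) (sets P) (emeasure P)"
      unfolding upper_variation_def sp assms(2)[symmetric]
    proof (rule measure_of_eq)
      fix A assume "A \<in> sigma_sets (space P) (sets P)"
      then have A: "A \<in> sets P" by (simp add: sets.sigma_sets_eq)
      show "(SUP B\<in>{B \<in> sets P. B \<subseteq> A}. ennreal (measure P B)) = emeasure P A"
        unfolding emeasure_eq_measure[symmetric]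
        by (rule antisym) (auto intro!: SUP_least SUP_upper emeasure_mono A)
    qed (rule sets.space_closed)
    then show ?thesis by (simp add: measure_of_of_measure)
  qed
  have low: "lower_variation M (measure P) = null_measure M"
  proof -
    have "(\<lambda>A. SUP B\<in>{B \<in> sets M. B \<subseteq> A}. ennreal (- measure P B)) = (\<lambda>A. 0)"
      by (auto simp: fun_eq_iff ennreal_neg intro!: antisym SUP_least)
    then show ?thesis
      unfolding lower_variation_def upper_variation_def
      by (simp add: null_measure_def)
  qed
  show ?thesis
    unfolding signed_integral_def up low by simp
qed

end

theory Submission imports Defs begin

text \<open>Cut \<open>X\<close> into finitely many small Borel pieces \<open>A\<^sub>i\<close> with points \<open>x\<^sub>i\<close>.  For signed measures,
  \<open>I(\<mu>, \<nu>)\<close> is the limit of \<open>\<Sum> \<mu>(A\<^sub>i) \<nu>(A\<^sub>j) d(x\<^sub>i, x\<^sub>j)\<close> as the mesh tends to 0, because the total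
  variations are finite.  These sums are visibly bilinear and symmetric, so \<open>I\<close> is too (no Fubini
  theorem is needed), and they are nonpositive for \<open>\<mu> = \<nu>\<close> of total mass 0 if \<open>X\<close> is
  quasihypermetric; this is \<open>(1) \<Longrightarrow> (3)\<close>.  Then \<open>(3) \<Longrightarrow> (5)\<close> by considering \<open>\<mu> - \<nu>\<close>,
  \<open>(6) \<Longrightarrow> (2)\<close> by uniform measures on \<open>n\<close> points, and \<open>(2) \<Longrightarrow> (1)\<close> by repeating points according
  to integer weights and approximating real weights by rational ones.  \<open>(3) \<Longrightarrow> (4)\<close> is the
  Cauchy-Schwarz inequality; conversely \<open>\<delta>\<^sub>x - \<delta>\<^sub>y\<close> has negative energy, so \<open>(4)\<close> forces every energy
  to be nonpositive.\<close>

section \<open>Jordan decomposition\<close>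

lemma finite_signed_measureD:
  assumes "finite_signed_measure M \<mu>"
  shows finite_signed_measure_empty: "\<mu> {} = 0"
    and finite_signed_measure_sums:
      "\<And>A::nat \<Rightarrow> _. range A \<subseteq> sets M \<Longrightarrow> disjoint_family A \<Longrightarrow> (\<lambda>n. \<mu> (A n)) sums \<mu> (\<Union>n. A n)"
  using assms by (auto simp: finite_signed_measure_def)

lemma finite_signed_measure_Un:
  assumes "finite_signed_measure M \<mu>" "A \<in> sets M" "B \<in> sets M" "A \<inter> B = {}"
  shows "\<mu> (A \<union> B) = \<mu> A + \<mu> B"
proof -
  have "(\<lambda>n. \<mu> (binaryset A B n)) sums \<mu> (\<Union>n. binaryset A B n)"
    by (rule finite_signed_measure_sums[OF assms(1)])
      (use assms in \<open>auto simp: range_binaryset_eq disjoint_family_on_def binaryset_def\<close>)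
  moreover have "(\<lambda>n. \<mu> (binaryset A B n)) sums (\<mu> A + \<mu> B)"
    by (rule binaryset_sums) (rule finite_signed_measure_empty[OF assms(1)])
  ultimately show ?thesis
    by (simp add: UN_binaryset_eq sums_unique2)
qed

lemma finite_signed_measure_UN:
  assumes \<mu>: "finite_signed_measure M \<mu>" and "finite I"
    and "\<And>i. i \<in> I \<Longrightarrow> A i \<in> sets M" "disjoint_family_on A I"
  shows "\<mu> (\<Union>i\<in>I. A i) = (\<Sum>i\<in>I. \<mu> (A i))"
  using assms(2-)
proof (induction I)
  case empty
  show ?case by (simp add: finite_signed_measure_empty[OF \<mu>])
next
  case (insert i I)
  have "A i \<inter> (\<Union>j\<in>I. A j) = {}"
    using insert.hyps insert.prems(2) by (fastforce simp: disjoint_family_on_def)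
  moreover have "disjoint_family_on A I"
    using insert.prems(2) by (rule disjoint_family_on_mono[rotated]) blast
  ultimately show ?case
    using insert by (simp add: finite_signed_measure_Un[OF \<mu>] sets.finite_UN)
qed

lemma finite_signed_measure_Int_Diff:
  assumes "finite_signed_measure M \<mu>" "A \<in> sets M" "B \<in> sets M"
  shows "\<mu> A = \<mu> (A \<inter> B) + \<mu> (A - B)"
  using finite_signed_measure_Un[OF assms(1), of "A \<inter> B" "A - B"] assms
  by (auto simp: Int_Diff_Un)

lemma finite_signed_measure_uminus:
  assumes "finite_signed_measure M \<mu>"
  shows "finite_signed_measure M (\<lambda>A. - \<mu> A)"
  using assms by (auto simp: finite_signed_measure_def intro: sums_minus)

lemma finite_signed_measure_sum:
  assumes "\<And>i. i \<in> I \<Longrightarrow> finite_signed_measure M (\<mu> i)"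
  shows "finite_signed_measure M (\<lambda>A. \<Sum>i\<in>I. c i * \<mu> i A)"
  using assms by (auto simp: finite_signed_measure_def intro!: sums_sum sums_mult)

text \<open>If \<open>\<mu>\<close> is unbounded on the subsets of \<open>E\<close>, some \<open>B \<subseteq> E\<close> has both \<open>\<bar>\<mu> B\<bar> > 1\<close> and
  \<open>\<bar>\<mu> (E - B)\<bar> > 1\<close>, and \<open>\<mu>\<close> is unbounded on one of the two.  Splitting off the other one
  repeatedly yields disjoint sets whose measures do not tend to 0.\<close>

lemma finite_signed_measure_bounded:
  assumes \<mu>: "finite_signed_measure M \<mu>"
  obtains c where "\<And>B. B \<in> sets M \<Longrightarrow> \<bar>\<mu> B\<bar> \<le> c"
proof -
  define bdd where "bdd E \<longleftrightarrow> (\<exists>c. \<forall>B\<in>sets M. B \<subseteq> E \<longrightarrow> \<bar>\<mu> B\<bar> \<le> c)" for E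
  have bdd_Un: "bdd E" if "bdd (E \<inter> B)" "bdd (E - B)" "E \<in> sets M" "B \<in> sets M" for E B
  proof -
    obtain c where c: "\<forall>C\<in>sets M. C \<subseteq> E \<inter> B \<longrightarrow> \<bar>\<mu> C\<bar> \<le> c"
      using \<open>bdd (E \<inter> B)\<close> unfolding bdd_def by (rule exE)
    obtain d where d: "\<forall>C\<in>sets M. C \<subseteq> E - B \<longrightarrow> \<bar>\<mu> C\<bar> \<le> d"
      using \<open>bdd (E - B)\<close> unfolding bdd_def by (rule exE)
    have "\<bar>\<mu> C\<bar> \<le> c + d" if C: "C \<in> sets M" "C \<subseteq> E" for C
    proof -
      have "\<mu> C = \<mu> (C \<inter> B) + \<mu> (C - B)"
        using finite_signed_measure_Int_Diff[OF \<mu> C(1) \<open>B \<in> sets M\<close>] .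
      moreover have "\<bar>\<mu> (C \<inter> B)\<bar> \<le> c" "\<bar>\<mu> (C - B)\<bar> \<le> d"
        using C \<open>B \<in> sets M\<close> c d by (simp_all add: le_infI1 Diff_mono)
      ultimately show ?thesis by linarith
    qed
    then show ?thesis unfolding bdd_def by blast
  qed
  have step: "\<exists>F. F \<in> sets M \<and> F \<subseteq> E \<and> \<not> bdd F \<and> 1 < \<bar>\<mu> (E - F)\<bar>"
    if E: "E \<in> sets M" "\<not> bdd E" for E
  proof -
    \<comment> \<open>The threshold \<open>1 + \<bar>\<mu> E\<bar>\<close> is chosen so that, by the
      triangle inequality, \<open>\<mu> B\<close> and
      \<open>\<mu> (E - B) = \<mu> E - \<mu> B\<close> both exceed 1 in absolute value.\<close>
    obtain B where B: "B \<in> sets M" "B \<subseteq> E" "1 + \<bar>\<mu> E\<bar> < \<bar>\<mu> B\<bar>"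
      using E(2) unfolding bdd_def by (metis not_le)
    have "\<mu> E = \<mu> B + \<mu> (E - B)"
      using finite_signed_measure_Int_Diff[OF \<mu> E(1) B(1)] B(2) by (simp add: Int_absorb1)
    then have gt: "1 < \<bar>\<mu> (E - B)\<bar>" "1 < \<bar>\<mu> B\<bar>" using B(3) by linarith+
    have "\<not> bdd B \<or> \<not> bdd (E - B)"
      using bdd_Un[of E B] E B by (auto simp: Int_absorb1)
    then show ?thesis
    proof
      assume "\<not> bdd B" then show ?thesis using B gt by blast
    next
      assume "\<not> bdd (E - B)"
      then show ?thesis using B gt E by (intro exI[of _ "E - B"]) (auto simp: double_diff)
    qed
  qed
  have "bdd (space M)"
  proof (rule ccontr)
    assume "\<not> bdd (space M)"
    \<comment> \<open>The invariant of the recursion is that \<open>E n\<close> is measurable and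
      \<open>\<mu>\<close> is unbounded on its subsets; the second conjunct relates consecutive
      sets.\<close>
    then have "\<exists>E. \<forall>n. (E n \<in> sets M \<and> \<not> bdd (E n)) \<and> (E (Suc n) \<subseteq> E n \<and> 1 < \<bar>\<mu> (E n - E (Suc n))\<bar>)"
      using step by (intro dependent_nat_choice) blast+
    then obtain E where E: "\<And>n. E n \<in> sets M" "\<And>n::nat. E (Suc n) \<subseteq> E n"
        "\<And>n. 1 < \<bar>\<mu> (E n - E (Suc n))\<bar>"
      by blast
    have dec: "E n \<subseteq> E m" if "m \<le> n" for m n
      using lift_Suc_antimono_le[of E, OF E(2) that] .
    have disj: "disjoint_family (\<lambda>n. E n - E (Suc n))"
    proof (unfold disjoint_family_on_def, intro ballI impI)
      fix m n :: nat assume "m \<noteq> n"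
      then show "(E m - E (Suc m)) \<inter> (E n - E (Suc n)) = {}"
      proof (induction m n rule: linorder_wlog)
        case (le a b)
        then have "E b \<subseteq> E (Suc a)" by (intro dec) simp
        then show ?case by blast
      qed blast
    qed
    have "summable (\<lambda>n. \<mu> (E n - E (Suc n)))"
      by (rule sums_summable[OF finite_signed_measure_sums[OF \<mu> _ disj]]) (use E(1) in auto)
    then have "(\<lambda>n. \<bar>\<mu> (E n - E (Suc n))\<bar>) \<longlonglongrightarrow> 0"
      using summable_LIMSEQ_zero tendsto_rabs_zero by blast
    then have "1 \<le> (0::real)"
      by (rule LIMSEQ_le_const) (use E(3) in \<open>auto intro: less_imp_le\<close>)
    then show False by simp
  qed
  then obtain c where "\<forall>B\<in>sets M. B \<subseteq> space M \<longrightarrow> \<bar>\<mu> B\<bar> \<le> c"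
    unfolding bdd_def by (rule exE)
  then show ?thesis by (intro that[of c]) (simp add: sets.sets_into_space)
qed

section \<open>The variations as finite measures\<close>

lemma sets_upper_variation [simp]: "sets (upper_variation M \<mu>) = sets M"
  and space_upper_variation [simp]: "space (upper_variation M \<mu>) = space M"
  by (simp_all add: upper_variation_def)

lemma sets_lower_variation [simp]: "sets (lower_variation M \<mu>) = sets M"
  and space_lower_variation [simp]: "space (lower_variation M \<mu>) = space M"
  by (simp_all add: lower_variation_def)

text \<open>\<open>measure_of\<close> returns the intended values only once the supremum is known to
  be countably additive. One inequality comes from superadditivity on disjoint sets. The other comes
  from cutting a competitor \<open>B\<close> along the sets \<open>A n\<close>.\<close>

lemma emeasure_upper_variation:
  assumes \<mu>: "finite_signed_measure M \<mu>" and A: "A \<in> sets M"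
  shows "emeasure (upper_variation M \<mu>) A = (SUP B\<in>{B \<in> sets M. B \<subseteq> A}. ennreal (\<mu> B))"
proof (rule emeasure_measure_of[OF upper_variation_def])
  let ?U = "\<lambda>A. SUP B\<in>{B \<in> sets M. B \<subseteq> A}. ennreal (\<mu> B)"
  have U_upper: "ennreal (\<mu> B) \<le> ?U A" if "B \<in> sets M" "B \<subseteq> A" for A B
    using that by (intro SUP_upper) auto
  have U_empty: "?U {} = 0"
  proof -
    have "{B \<in> sets M. B \<subseteq> {}} = {{}}" by auto
    then show ?thesis by (simp add: finite_signed_measure_empty[OF \<mu>])
  qed
  have U_mono: "?U A \<le> ?U B" if "A \<subseteq> B" for A B
    using that by (intro SUP_subset_mono order_refl) auto
  show "sets M \<subseteq> Pow (space M)" by (rule sets.space_closed)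
  show "positive (sets (upper_variation M \<mu>)) ?U"
    unfolding positive_def by (rule U_empty)
  show "A \<in> sets (upper_variation M \<mu>)" using A by simp
  have U_Un: "?U A + ?U B \<le> ?U (A \<union> B)" if "A \<in> sets M" "B \<in> sets M" "A \<inter> B = {}" for A B
  proof -
    have ne: "{B \<in> sets M. B \<subseteq> A} \<noteq> {}" for A :: "'a set" by auto
    show ?thesis
    proof (subst ennreal_SUP_add_left[symmetric, OF ne], rule SUP_least)
      fix C assume C: "C \<in> {C \<in> sets M. C \<subseteq> A}"
      show "ennreal (\<mu> C) + ?U B \<le> ?U (A \<union> B)"
      proof (subst ennreal_SUP_add_right[OF ne], rule SUP_least)
        fix D assume D: "D \<in> {C \<in> sets M. C \<subseteq> B}"
        have CD: "\<mu> (C \<union> D) = \<mu> C + \<mu> D"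
          using C D that by (intro finite_signed_measure_Un[OF \<mu>]) auto
        show "ennreal (\<mu> C) + ennreal (\<mu> D) \<le> ?U (A \<union> B)"
        \<comment> \<open>\<open>ennreal\<close> turns negative values into 0, so a competitor of
          negative measure is simply dropped; only if both are nonnegative is their union
          used.\<close>
        proof (cases "0 \<le> \<mu> C"; cases "0 \<le> \<mu> D")
          assume "0 \<le> \<mu> C" "0 \<le> \<mu> D"
          then have "ennreal (\<mu> C) + ennreal (\<mu> D) = ennreal (\<mu> (C \<union> D))"
            by (simp add: CD)
          also have "\<dots> \<le> ?U (A \<union> B)" using C D by (intro U_upper) auto
          finally show ?thesis .
        next
          assume "0 \<le> \<mu> C" "\<not> 0 \<le> \<mu> D"
          then show ?thesis using U_upper[of C "A \<union> B"] C by (auto simp: ennreal_neg)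
        next
          assume "\<not> 0 \<le> \<mu> C" "0 \<le> \<mu> D"
          then show ?thesis using U_upper[of D "A \<union> B"] D by (auto simp: ennreal_neg)
        next
          assume "\<not> 0 \<le> \<mu> C" "\<not> 0 \<le> \<mu> D"
          then show ?thesis by (simp add: ennreal_neg)
        qed
      qed
    qed
  qed
  show "countably_additive (sets (upper_variation M \<mu>)) ?U"
  proof (rule countably_additiveI)
    fix A :: "nat \<Rightarrow> 'a set"
    assume "range A \<subseteq> sets (upper_variation M \<mu>)" and disj: "disjoint_family A"
    then have A: "\<And>n. A n \<in> sets M" by auto
    have disj': "A n \<inter> A k = {}" if "n < k" for n k
      using disj that by (auto simp: disjoint_family_on_def)
    have "(\<Sum>n<k. ?U (A n)) \<le> ?U (\<Union>n<k. A n)" for k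
    proof (induction k)
      case (Suc k)
      have "(\<Sum>n<Suc k. ?U (A n)) \<le> ?U (\<Union>n<k. A n) + ?U (A k)"
        using Suc by (simp add: add_right_mono)
      also have "\<dots> \<le> ?U ((\<Union>n<k. A n) \<union> A k)"
        by (rule U_Un) (use A disj' in auto)
      also have "(\<Union>n<k. A n) \<union> A k = (\<Union>n<Suc k. A n)"
        by (auto simp: less_Suc_eq)
      finally show ?case .
    qed simp
    also have "?U (\<Union>n<k. A n) \<le> ?U (\<Union>n. A n)" for k
      by (rule U_mono) auto
    finally have le: "(\<Sum>n. ?U (A n)) \<le> ?U (\<Union>n. A n)"
      by (intro suminf_le_const) (auto simp del: sum.lessThan_Suc)
    have "ennreal (\<mu> B) \<le> (\<Sum>n. ?U (A n))" if B: "B \<in> sets M" "B \<subseteq> (\<Union>n. A n)" for B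
    proof (cases "(\<Sum>n. ?U (A n)) = top")
      case False
      have sums: "(\<lambda>n. \<mu> (B \<inter> A n)) sums \<mu> (\<Union>n. B \<inter> A n)"
        using A B
        by (intro finite_signed_measure_sums[OF \<mu>] disjoint_family_subset[OF disj]) auto
      have Beq: "(\<Union>n. B \<inter> A n) = B" using B by auto
      have "ennreal (\<Sum>n<k. \<mu> (B \<inter> A n)) \<le> (\<Sum>n. ?U (A n))" for k
      proof -
        \<comment> \<open>\<open>ennreal\<close> commutes with sums of nonnegative terms only, so
          the terms are first replaced by their positive parts.\<close>
        have "ennreal (\<Sum>n<k. \<mu> (B \<inter> A n)) \<le> ennreal (\<Sum>n<k. max 0 (\<mu> (B \<inter> A n)))"
          by (intro ennreal_leI sum_mono) auto
        also have "\<dots> = (\<Sum>n<k. ennreal (max 0 (\<mu> (B \<inter> A n))))"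
          by (subst sum_ennreal) auto
        also have "\<dots> \<le> (\<Sum>n<k. ?U (A n))"
          using A B by (intro sum_mono) (auto intro!: U_upper simp: ennreal_max_0)
        also have "\<dots> \<le> (\<Sum>n. ?U (A n))" by (rule sum_le_suminf) auto
        finally show ?thesis .
      qed
      moreover have "(\<lambda>k. ennreal (\<Sum>n<k. \<mu> (B \<inter> A n))) \<longlonglongrightarrow> ennreal (\<mu> B)"
        using sums unfolding sums_def Beq by (rule tendsto_ennrealI)
      ultimately show ?thesis by (intro LIMSEQ_le_const2) auto
    qed simp
    then have "?U (\<Union>n. A n) \<le> (\<Sum>n. ?U (A n))" by (intro SUP_least) auto
    with le show "(\<Sum>n. ?U (A n)) = ?U (\<Union>n. A n)" by (rule antisym)
  qed
qed

lemma finite_measure_upper_variation: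
  assumes \<mu>: "finite_signed_measure M \<mu>"
  shows "finite_measure (upper_variation M \<mu>)"
proof
  obtain c where "\<And>B. B \<in> sets M \<Longrightarrow> \<bar>\<mu> B\<bar> \<le> c"
    using finite_signed_measure_bounded[OF \<mu>] by blast
  then have "\<And>B. B \<in> sets M \<Longrightarrow> \<mu> B \<le> c" by (simp add: abs_le_iff)
  then have "emeasure (upper_variation M \<mu>) (space M) \<le> ennreal c"
    by (auto simp: emeasure_upper_variation[OF \<mu>] intro!: SUP_least ennreal_leI)
  then show "emeasure (upper_variation M \<mu>) (space (upper_variation M \<mu>)) \<noteq> \<infinity>"
    by (auto simp: top_unique)
qed

lemma finite_measure_lower_variation:
  "finite_signed_measure M \<mu> \<Longrightarrow> finite_measure (lower_variation M \<mu>)"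
  unfolding lower_variation_def
  by (rule finite_measure_upper_variation[OF finite_signed_measure_uminus])

lemma le_measure_upper_variation:
  assumes \<mu>: "finite_signed_measure M \<mu>" and "A \<in> sets M" "B \<in> sets M" "B \<subseteq> A"
  shows "\<mu> B \<le> measure (upper_variation M \<mu>) A"
proof -
  interpret finite_measure "upper_variation M \<mu>" by (rule finite_measure_upper_variation[OF \<mu>])
  have "ennreal (\<mu> B) \<le> emeasure (upper_variation M \<mu>) A"
    unfolding emeasure_upper_variation[OF \<mu> \<open>A \<in> sets M\<close>] using assms by (intro SUP_upper) auto
  then show ?thesis by (simp add: emeasure_eq_measure ennreal_le_iff)
qed

text \<open>For measurable \<open>B \<subseteq> A\<close>, the identity
  \<open>- \<mu> B = \<mu> (A - B) - \<mu> A\<close> bounds \<open>- \<mu> B\<close> by the upper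
  variation of \<open>A\<close> minus \<open>\<mu> A\<close>; then the supremum over
  \<open>B\<close> is taken.\<close>

lemma measure_lower_variation_le:
  assumes \<mu>: "finite_signed_measure M \<mu>" and A: "A \<in> sets M"
  shows "measure (lower_variation M \<mu>) A \<le> measure (upper_variation M \<mu>) A - \<mu> A"
proof -
  interpret L: finite_measure "lower_variation M \<mu>" by (rule finite_measure_lower_variation[OF \<mu>])
  have "- \<mu> B \<le> measure (upper_variation M \<mu>) A - \<mu> A" if "B \<in> sets M" "B \<subseteq> A" for B
    using finite_signed_measure_Int_Diff[OF \<mu> A that(1)] that A
      le_measure_upper_variation[OF \<mu> A, of "A - B"]
    by (auto simp: Int_absorb1)
  then have "emeasure (lower_variation M \<mu>) A \<le> ennreal (measure (upper_variation M \<mu>) A - \<mu> A)"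
    unfolding lower_variation_def
    by (subst emeasure_upper_variation[OF finite_signed_measure_uminus[OF \<mu>] A])
      (auto intro!: SUP_least ennreal_leI)
  moreover have "0 \<le> measure (upper_variation M \<mu>) A - \<mu> A"
    using le_measure_upper_variation[OF \<mu> A A] by simp
  ultimately show ?thesis by (simp add: L.emeasure_eq_measure)
qed

text \<open>Negating \<open>\<mu>\<close> exchanges the two variations, so the preceding inequality
  for \<open>\<mu>\<close> and for \<open>- \<mu>\<close> gives both halves of the equation.\<close>

lemma Jordan_decomposition:
  assumes \<mu>: "finite_signed_measure M \<mu>" and A: "A \<in> sets M"
  shows "\<mu> A = measure (upper_variation M \<mu>) A - measure (lower_variation M \<mu>) A"
proof -
  have "lower_variation M (\<lambda>A. - \<mu> A) = upper_variation M \<mu>"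
    by (simp add: lower_variation_def)
  then show ?thesis
    using measure_lower_variation_le[OF \<mu> A]
      measure_lower_variation_le[OF finite_signed_measure_uminus[OF \<mu>] A]
    by (simp add: lower_variation_def)
qed

section \<open>Integration against a signed measure\<close>

definition total_variation :: "'a measure \<Rightarrow> ('a set \<Rightarrow> real) \<Rightarrow> real" where
  "total_variation M \<mu> =
    measure (upper_variation M \<mu>) (space M) + measure (lower_variation M \<mu>) (space M)"

lemma total_variation_nonneg: "0 \<le> total_variation M \<mu>"
  by (simp add: total_variation_def)

text \<open>The step function with value \<open>c i\<close> on \<open>A i\<close> is within
  \<open>\<epsilon>\<close> of \<open>f\<close> at every point, because each point lies in exactly
  one piece.\<close>

lemma (in finite_measure) integral_approx:
  fixes f :: "'a \<Rightarrow> real"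
  assumes A: "\<And>i. i \<in> I \<Longrightarrow> A i \<in> sets M" "disjoint_family_on A I" "(\<Union>i\<in>I. A i) = space M" "finite I"
    and f: "integrable M f"
    and close: "\<And>i y. i \<in> I \<Longrightarrow> y \<in> A i \<Longrightarrow> \<bar>f y - c i\<bar> \<le> \<epsilon>"
  shows "\<bar>integral\<^sup>L M f - (\<Sum>i\<in>I. c i * measure M (A i))\<bar> \<le> \<epsilon> * measure M (space M)"
proof -
  let ?g = "\<lambda>y. \<Sum>i\<in>I. c i * indicator (A i) y"
  have g: "integrable M ?g"
    using A(1) by (intro Bochner_Integration.integrable_sum integrable_mult_right)
      (auto simp: emeasure_eq_measure)
  have gint: "integral\<^sup>L M ?g = (\<Sum>i\<in>I. c i * measure M (A i))"
    using A(1) by (subst Bochner_Integration.integral_sum)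
      (auto simp: emeasure_eq_measure intro!: sum.cong)
  have bound: "\<bar>f y - ?g y\<bar> \<le> \<epsilon>" if y: "y \<in> space M" for y
  proof -
    obtain i where i: "i \<in> I" "y \<in> A i" using A(3) y by blast
    have "?g y = (\<Sum>j\<in>I. if j = i then c i else 0)"
    proof (rule sum.cong)
      fix j assume "j \<in> I"
      then show "c j * indicator (A j) y = (if j = i then c i else 0)"
        using A(2) i by (auto simp: disjoint_family_on_def indicator_def)
    qed simp
    then have "?g y = c i" using i \<open>finite I\<close> by simp
    then show ?thesis using close[OF i] by simp
  qed
  have "\<bar>integral\<^sup>L M f - integral\<^sup>L M ?g\<bar> = \<bar>integral\<^sup>L M (\<lambda>y. f y - ?g y)\<bar>"
    using f g by simp
  also have "\<dots> \<le> (\<integral>y. \<bar>f y - ?g y\<bar> \<partial>M)" by (rule integral_abs_bound)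
  also have "\<dots> \<le> (\<integral>y. \<epsilon> \<partial>M)"
    using f g bound by (intro integral_mono) auto
  finally show ?thesis by (simp add: gint mult.commute)
qed

text \<open>The previous estimate is applied to both variations. Subtracting the two sums gives the
  sum against \<open>\<mu>\<close> by the Jordan decomposition, while the two errors add up to a
  multiple of the total variation.\<close>

lemma signed_integral_approx:
  assumes \<mu>: "finite_signed_measure M \<mu>"
    and A: "\<And>i. i \<in> I \<Longrightarrow> A i \<in> sets M" "disjoint_family_on A I" "(\<Union>i\<in>I. A i) = space M" "finite I"
    and f: "f \<in> borel_measurable M" "\<And>y. y \<in> space M \<Longrightarrow> \<bar>f y\<bar> \<le> K"
    and close: "\<And>i y. i \<in> I \<Longrightarrow> y \<in> A i \<Longrightarrow> \<bar>f y - c i\<bar> \<le> \<epsilon>"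
  shows "\<bar>signed_integral M \<mu> f - (\<Sum>i\<in>I. c i * \<mu> (A i))\<bar> \<le> \<epsilon> * total_variation M \<mu>"
proof -
  let ?P = "upper_variation M \<mu>" and ?N = "lower_variation M \<mu>"
  interpret P: finite_measure ?P by (rule finite_measure_upper_variation[OF \<mu>])
  interpret N: finite_measure ?N by (rule finite_measure_lower_variation[OF \<mu>])
  have "f \<in> borel_measurable ?P" "f \<in> borel_measurable ?N"
    using f(1) by (simp_all cong: measurable_cong_sets)
  then have int: "integrable ?P f" "integrable ?N f"
    using f(2) by (auto intro!: P.integrable_const_bound[of _ K] N.integrable_const_bound[of _ K])
  have "(\<Sum>i\<in>I. c i * \<mu> (A i)) = (\<Sum>i\<in>I. c i * measure ?P (A i)) - (\<Sum>i\<in>I. c i * measure ?N (A i))"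
    unfolding sum_subtractf[symmetric]
    by (intro sum.cong) (auto simp: Jordan_decomposition[OF \<mu> A(1)] right_diff_distrib)
  moreover have "\<bar>integral\<^sup>L ?P f - (\<Sum>i\<in>I. c i * measure ?P (A i))\<bar> \<le> \<epsilon> * measure ?P (space ?P)"
    by (rule P.integral_approx) (use A int close in auto)
  moreover have "\<bar>integral\<^sup>L ?N f - (\<Sum>i\<in>I. c i * measure ?N (A i))\<bar> \<le> \<epsilon> * measure ?N (space ?N)"
    by (rule N.integral_approx) (use A int close in auto)
  ultimately show ?thesis
    unfolding signed_integral_def total_variation_def by (simp add: distrib_left)
qed

lemma signed_integral_diff_le:
  assumes \<mu>: "finite_signed_measure M \<mu>"
    and f: "f \<in> borel_measurable M" "\<And>y. y \<in> space M \<Longrightarrow> \<bar>f y\<bar> \<le> K"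
    and g: "g \<in> borel_measurable M" "\<And>y. y \<in> space M \<Longrightarrow> \<bar>g y\<bar> \<le> K"
    and close: "\<And>y. y \<in> space M \<Longrightarrow> \<bar>f y - g y\<bar> \<le> \<epsilon>"
  shows "\<bar>signed_integral M \<mu> f - signed_integral M \<mu> g\<bar> \<le> \<epsilon> * total_variation M \<mu>"
proof -
  let ?P = "upper_variation M \<mu>" and ?N = "lower_variation M \<mu>"
  interpret P: finite_measure ?P by (rule finite_measure_upper_variation[OF \<mu>])
  interpret N: finite_measure ?N by (rule finite_measure_lower_variation[OF \<mu>])
  have m: "f \<in> borel_measurable ?P" "f \<in> borel_measurable ?N"
      "g \<in> borel_measurable ?P" "g \<in> borel_measurable ?N"
    using f(1) g(1) by (simp_all cong: measurable_cong_sets)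
  then have int: "integrable ?P f" "integrable ?N f" "integrable ?P g" "integrable ?N g"
    using f(2) g(2)
    by (auto intro!: P.integrable_const_bound[of _ K] N.integrable_const_bound[of _ K])
  have "signed_integral M \<mu> f - signed_integral M \<mu> g
      = (\<integral>y. f y - g y \<partial>?P) - (\<integral>y. f y - g y \<partial>?N)"
    using int by (simp add: signed_integral_def)
  \<comment> \<open>The partition into a single piece with value 0 turns the approximation lemma
    into the usual bound of an integral by supremum times mass.\<close>
  moreover have "\<bar>\<integral>y. f y - g y \<partial>?P\<bar> \<le> \<epsilon> * measure ?P (space M)"
    using P.integral_approx[of "{()}" "\<lambda>_. space M" "\<lambda>y. f y - g y" "\<lambda>_. 0" \<epsilon>] close int m
    by (auto simp: disjoint_family_on_def)
  moreover have "\<bar>\<integral>y. f y - g y \<partial>?N\<bar> \<le> \<epsilon> * measure ?N (space M)"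
    using N.integral_approx[of "{()}" "\<lambda>_. space M" "\<lambda>y. f y - g y" "\<lambda>_. 0" \<epsilon>] close int m
    by (auto simp: disjoint_family_on_def)
  ultimately show ?thesis unfolding total_variation_def by (simp add: distrib_left)
qed

text \<open>\<open>\<bar>\<mu> (A i)\<bar>\<close> is at most the sum of the two variations of
  \<open>A i\<close>, and these are additive over disjoint pieces.\<close>

lemma sum_abs_le_total_variation:
  assumes \<mu>: "finite_signed_measure M \<mu>"
    and A: "\<And>i. i \<in> I \<Longrightarrow> A i \<in> sets M" "disjoint_family_on A I" "finite I"
  shows "(\<Sum>i\<in>I. \<bar>\<mu> (A i)\<bar>) \<le> total_variation M \<mu>"
proof -
  let ?P = "upper_variation M \<mu>" and ?N = "lower_variation M \<mu>"
  interpret P: finite_measure ?P by (rule finite_measure_upper_variation[OF \<mu>])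
  interpret N: finite_measure ?N by (rule finite_measure_lower_variation[OF \<mu>])
  have "(\<Sum>i\<in>I. \<bar>\<mu> (A i)\<bar>) \<le> (\<Sum>i\<in>I. measure ?P (A i) + measure ?N (A i))"
    by (intro sum_mono)
      (auto simp: Jordan_decomposition[OF \<mu> A(1)] abs_le_iff intro: add_increasing add_increasing2)
  also have "\<dots> = measure ?P (\<Union>i\<in>I. A i) + measure ?N (\<Union>i\<in>I. A i)"
    using A by (subst (1 2) measure_finite_Union) 
      (auto simp: sum.distrib P.emeasure_eq_measure N.emeasure_eq_measure)
  also have "\<dots> \<le> total_variation M \<mu>"
    using A unfolding total_variation_def
    by (intro add_mono P.finite_measure_mono N.finite_measure_mono)
      (auto dest: sets.sets_into_space)
  finally show ?thesis .
qed

section \<open>Discretization of the energy\<close>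

text \<open>A finite subcover by balls centred in \<open>X\<close> is made disjoint by removing from
  each ball the earlier ones. The centre \<open>x i\<close> may thus lie outside \<open>A i\<close>,
  and \<open>A i\<close> may be empty; only the distance bound matters later.\<close>

lemma compact_small_partition:
  fixes X :: "'a::metric_space set"
  assumes "compact X" "0 < \<epsilon>"
  obtains n :: nat and x A where "\<And>i. i < n \<Longrightarrow> x i \<in> X" "\<And>i. i < n \<Longrightarrow> A i \<in> sets (borel_on X)"
    "disjoint_family_on A {..<n}" "(\<Union>i<n. A i) = X"
    "\<And>i y. i < n \<Longrightarrow> y \<in> A i \<Longrightarrow> dist y (x i) \<le> \<epsilon>"
proof -
  obtain F where F: "F \<subseteq> X" "finite F" "X \<subseteq> (\<Union>x\<in>F. ball x \<epsilon>)"
    by (rule compactE_image[OF assms(1), of X "\<lambda>x. ball x \<epsilon>"]) (use assms(2) in auto)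
  obtain x where x: "bij_betw x {..<card F} F"
    using ex_bij_betw_nat_finite[OF F(2)] by (auto simp: lessThan_atLeast0)
  define A where "A i = X \<inter> disjointed (\<lambda>i. ball (x i) \<epsilon>) i" for i
  show ?thesis
  proof
    show "x i \<in> X" if "i < card F" for i
      using x that F(1) by (auto simp: bij_betw_def)
    have "range (disjointed (\<lambda>i. ball (x i) \<epsilon>)) \<subseteq> sets borel"
      by (intro sets.range_disjointed_sets) auto
    then show "A i \<in> sets (borel_on X)" for i
      by (auto simp: A_def sets_restrict_space)
    show "disjoint_family_on A {..<card F}"
      using disjoint_family_disjointed[of "\<lambda>i. ball (x i) \<epsilon>"]
      unfolding A_def disjoint_family_on_def by blast
    have "(\<Union>i<card F. ball (x i) \<epsilon>) = (\<Union>x\<in>F. ball x \<epsilon>)"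
      using arg_cong[OF bij_betw_imp_surj_on[OF x], of "\<lambda>F. \<Union>x\<in>F. ball x \<epsilon>"] by simp
    then show "(\<Union>i<card F. A i) = X"
      using F(3) finite_UN_disjointed_eq[of "\<lambda>i. ball (x i) \<epsilon>" "card F"]
      by (auto simp: A_def lessThan_atLeast0)
    show "dist y (x i) \<le> \<epsilon>" if "y \<in> A i" for y i
      using that disjointed_subset[of "\<lambda>i. ball (x i) \<epsilon>" i]
      by (auto simp: A_def dist_commute intro: less_imp_le)
  qed
qed

text \<open>Each of the two integrations contributes one error
  \<open>\<epsilon> * ?V \<mu> * ?V \<nu>\<close>. First the outer integral of the potential
  \<open>g\<close> is replaced by a sum over the points \<open>x j\<close>, then each
  \<open>g (x j)\<close> by a sum over the \<open>x i\<close>.\<close>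

lemma mutual_energy_approx:
  fixes X :: "'a::metric_space set"
  assumes X: "compact X" and "0 \<le> \<epsilon>"
    and \<mu>: "\<mu> \<in> signed_measures X" and \<nu>: "\<nu> \<in> signed_measures X"
    and x: "\<And>i. i \<in> I \<Longrightarrow> x i \<in> X"
    and A: "\<And>i. i \<in> I \<Longrightarrow> A i \<in> sets (borel_on X)" "disjoint_family_on A I" "(\<Union>i\<in>I. A i) = X" "finite I"
    and close: "\<And>i y. i \<in> I \<Longrightarrow> y \<in> A i \<Longrightarrow> dist y (x i) \<le> \<epsilon>"
  shows "\<bar>mutual_energy X \<mu> \<nu> - (\<Sum>i\<in>I. \<Sum>j\<in>I. \<mu> (A i) * \<nu> (A j) * dist (x i) (x j))\<bar>
    \<le> 2 * \<epsilon> * total_variation (borel_on X) \<mu> * total_variation (borel_on X) \<nu>"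
proof -
  let ?M = "borel_on X"
  let ?V = "total_variation ?M"
  define g where "g y = signed_integral ?M \<mu> (\<lambda>x. dist x y)" for y
  have fm: "finite_signed_measure ?M \<mu>" "finite_signed_measure ?M \<nu>"
    using \<mu> \<nu> by (auto simp: signed_measures_def)
  have sp: "space ?M = X" by (simp add: space_restrict_space)
  obtain D where D: "\<And>x y. x \<in> X \<Longrightarrow> y \<in> X \<Longrightarrow> dist x y \<le> D"
    using compact_imp_bounded[OF X] unfolding bounded_two_points by blast
  have dm: "(\<lambda>x. dist x y) \<in> borel_measurable ?M" for y
    by (intro borel_measurable_continuous_on_restrict continuous_intros)
  \<comment> \<open>The Lipschitz bound serves twice: it makes \<open>g\<close> continuous, hence
    measurable and bounded on the compact \<open>X\<close>, and it controls the oscillation of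
    \<open>g\<close> on each piece.\<close>
  have g_lip: "\<bar>g y - g z\<bar> \<le> dist y z * ?V \<mu>" if "y \<in> X" "z \<in> X" for y z
    unfolding g_def
  proof (rule signed_integral_diff_le[OF fm(1) dm _ dm, where K = D])
    show "\<bar>dist x y - dist x z\<bar> \<le> dist y z" for x
      using dist_triangle[of x y z] dist_triangle[of x z y] by (simp add: dist_commute abs_le_iff)
  qed (use D that in \<open>auto simp: sp\<close>)
  have "continuous_on X g"
    by (rule lipschitz_on_continuous_on[where L = "?V \<mu>"], rule lipschitz_onI) (use g_lip in \<open>auto simp: dist_real_def mult.commute total_variation_nonneg\<close>)
  then have gm: "g \<in> borel_measurable ?M" and "bounded (g ` X)"
    by (auto intro: borel_measurable_continuous_on_restrict compact_imp_bounded compact_continuous_image X)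
  then obtain K where K: "\<And>y. y \<in> X \<Longrightarrow> \<bar>g y\<bar> \<le> K"
    by (auto simp: bounded_iff)
  have 1: "\<bar>mutual_energy X \<mu> \<nu> - (\<Sum>j\<in>I. g (x j) * \<nu> (A j))\<bar> \<le> (\<epsilon> * ?V \<mu>) * ?V \<nu>"
    unfolding mutual_energy_def g_def[symmetric]
  proof (rule signed_integral_approx[OF fm(2) A(1,2)])
    fix j y assume j: "j \<in> I" "y \<in> A j"
    then have "y \<in> X" using A(3) by auto
    then have "\<bar>g y - g (x j)\<bar> \<le> dist y (x j) * ?V \<mu>" by (rule g_lip) (use j x in auto)
    also have "\<dots> \<le> \<epsilon> * ?V \<mu>" by (intro mult_right_mono close j total_variation_nonneg)
    finally show "\<bar>g y - g (x j)\<bar> \<le> \<epsilon> * ?V \<mu>" .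
  qed (use A gm K in \<open>auto simp: sp\<close>)
  have 2: "\<bar>g (x j) - (\<Sum>i\<in>I. dist (x i) (x j) * \<mu> (A i))\<bar> \<le> \<epsilon> * ?V \<mu>" if j: "j \<in> I" for j
    unfolding g_def
  proof (rule signed_integral_approx[OF fm(1) A(1,2), where K = D])
    fix i y assume "i \<in> I" "y \<in> A i"
    then have "dist y (x i) \<le> \<epsilon>" by (rule close)
    moreover have "\<bar>dist y (x j) - dist (x i) (x j)\<bar> \<le> dist y (x i)"
      using dist_triangle[of y "x j" "x i"] dist_triangle[of "x i" "x j" y]
      by (simp add: dist_commute abs_le_iff)
    ultimately show "\<bar>dist y (x j) - dist (x i) (x j)\<bar> \<le> \<epsilon>" by simp
  qed (use A dm D x j in \<open>auto simp: sp\<close>)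
  have "\<bar>(\<Sum>j\<in>I. g (x j) * \<nu> (A j)) - (\<Sum>j\<in>I. (\<Sum>i\<in>I. dist (x i) (x j) * \<mu> (A i)) * \<nu> (A j))\<bar>
      = \<bar>\<Sum>j\<in>I. (g (x j) - (\<Sum>i\<in>I. dist (x i) (x j) * \<mu> (A i))) * \<nu> (A j)\<bar>"
    by (simp add: sum_subtractf left_diff_distrib)
  also have "\<dots> \<le> (\<Sum>j\<in>I. \<bar>(g (x j) - (\<Sum>i\<in>I. dist (x i) (x j) * \<mu> (A i))) * \<nu> (A j)\<bar>)"
    by (rule sum_abs)
  \<comment> \<open>The inner error is uniform in \<open>j\<close>, so only the sum of the
    \<open>\<bar>\<nu> (A j)\<bar>\<close> remains, and this is at most the total variation of
    \<open>\<nu>\<close>, however many pieces there are.\<close>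
  also have "\<dots> \<le> (\<Sum>j\<in>I. (\<epsilon> * ?V \<mu>) * \<bar>\<nu> (A j)\<bar>)"
    unfolding abs_mult by (intro sum_mono mult_right_mono 2) auto
  also have "\<dots> = (\<epsilon> * ?V \<mu>) * (\<Sum>j\<in>I. \<bar>\<nu> (A j)\<bar>)" by (simp add: sum_distrib_left)
  also have "\<dots> \<le> (\<epsilon> * ?V \<mu>) * ?V \<nu>"
    using A \<open>0 \<le> \<epsilon>\<close>
    by (intro mult_left_mono sum_abs_le_total_variation fm(2)) (auto simp: total_variation_nonneg)
  also have "(\<Sum>j\<in>I. (\<Sum>i\<in>I. dist (x i) (x j) * \<mu> (A i)) * \<nu> (A j))
      = (\<Sum>i\<in>I. \<Sum>j\<in>I. \<mu> (A i) * \<nu> (A j) * dist (x i) (x j))"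
    by (subst sum.swap) (simp add: sum_distrib_left mult_ac)
  finally show ?thesis using 1 by linarith
qed

text \<open>The points and pieces are chosen before the measures, so one sequence of partitions
  serves all measures at once. Hence identities and inequalities between finite sums pass to the
  limit.\<close>

lemma mutual_energy_discretization:
  fixes X :: "'a::metric_space set"
  assumes X: "compact X"
  obtains n :: "nat \<Rightarrow> nat" and x A where "\<And>k i. i < n k \<Longrightarrow> x k i \<in> X"
    "\<And>\<mu> k. \<mu> \<in> signed_measures X \<Longrightarrow> (\<Sum>i<n k. \<mu> (A k i)) = \<mu> X"
    "\<And>\<mu> \<nu>. \<mu> \<in> signed_measures X \<Longrightarrow> \<nu> \<in> signed_measures X \<Longrightarrow>
      (\<lambda>k. \<Sum>i<n k. \<Sum>j<n k. \<mu> (A k i) * \<nu> (A k j) * dist (x k i) (x k j))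
        \<longlonglongrightarrow> mutual_energy X \<mu> \<nu>"
proof -
  have "\<exists>(n::nat) x A. (\<forall>i<n. x i \<in> X) \<and> (\<forall>i<n. A i \<in> sets (borel_on X)) \<and>
    disjoint_family_on A {..<n} \<and> (\<Union>i<n. A i) = X \<and>
    (\<forall>i<n. \<forall>y\<in>A i. dist y (x i) \<le> 1 / real (Suc k))" for k
  proof -
    have "0 < 1 / real (Suc k)" by simp
    from compact_small_partition[OF X this]
    obtain n :: nat and x A where "\<And>i. i < n \<Longrightarrow> x i \<in> X" "\<And>i. i < n \<Longrightarrow> A i \<in> sets (borel_on X)"
      "disjoint_family_on A {..<n}" "(\<Union>i<n. A i) = X"
      "\<And>i y. i < n \<Longrightarrow> y \<in> A i \<Longrightarrow> dist y (x i) \<le> 1 / real (Suc k)"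
      by blast
    then show ?thesis by (intro exI[of _ n] exI[of _ x] exI[of _ A]) simp
  qed
  then obtain n :: "nat \<Rightarrow> nat" and x A where *: "\<And>k i. i < n k \<Longrightarrow> x k i \<in> X"
      "\<And>k i. i < n k \<Longrightarrow> A k i \<in> sets (borel_on X)"
      "\<And>k. disjoint_family_on (A k) {..<n k}" "\<And>k. (\<Union>i<n k. A k i) = X"
      "\<And>k i y. i < n k \<Longrightarrow> y \<in> A k i \<Longrightarrow> dist y (x k i) \<le> 1 / real (Suc k)"
    by metis
  show ?thesis
  proof (rule that[of n x A])
    fix \<mu> \<nu> assume \<mu>\<nu>: "\<mu> \<in> signed_measures X" "\<nu> \<in> signed_measures X"
    let ?C = "total_variation (borel_on X) \<mu> * total_variation (borel_on X) \<nu>"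
    let ?L = "\<lambda>k. \<Sum>i<n k. \<Sum>j<n k. \<mu> (A k i) * \<nu> (A k j) * dist (x k i) (x k j)"
    \<comment> \<open>The \<open>k\<close>-th partition has mesh \<open>1 / Suc k\<close>, and the
      total variations do not depend on \<open>k\<close>.\<close>
    have "\<bar>mutual_energy X \<mu> \<nu> - ?L k\<bar> \<le> 2 * (1 / real (Suc k)) * total_variation (borel_on X) \<mu> * total_variation (borel_on X) \<nu>" for k
      by (rule mutual_energy_approx[OF X _ \<mu>\<nu>]) (use * in simp_all)
    then have bound: "\<bar>?L k - mutual_energy X \<mu> \<nu>\<bar> \<le> 2 * ?C * inverse (real (Suc k))" for k
      by (subst abs_minus_commute) (simp add: mult_ac inverse_eq_divide)
    have "(\<lambda>k. 2 * ?C * inverse (real (Suc k))) \<longlonglongrightarrow> 0"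
      using tendsto_mult_right_zero[OF LIMSEQ_inverse_real_of_nat] by simp
    then have "(\<lambda>k. ?L k - mutual_energy X \<mu> \<nu>) \<longlonglongrightarrow> 0"
      by (rule Lim_null_comparison[rotated]) (intro always_eventually allI, unfold real_norm_def, rule bound)
    then show "?L \<longlonglongrightarrow> mutual_energy X \<mu> \<nu>" by (rule LIM_zero_cancel)
  next
    fix \<mu> k assume \<mu>: "\<mu> \<in> signed_measures X"
    then show "(\<Sum>i<n k. \<mu> (A k i)) = \<mu> X"
      using finite_signed_measure_UN[of "borel_on X" \<mu> "{..<n k}" "A k"] *
      by (simp add: signed_measures_def)
  qed (fact *)
qed

section \<open>Symmetry and bilinearity of the mutual energy\<close>

lemma signed_measures_sum:
  "(\<And>i. i \<in> I \<Longrightarrow> \<mu> i \<in> signed_measures X) \<Longrightarrow> (\<lambda>A. \<Sum>i\<in>I. c i * \<mu> i A) \<in> signed_measures X"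
  by (auto simp: signed_measures_def intro: finite_signed_measure_sum)

lemma mutual_energy_commute:
  fixes X :: "'a::metric_space set"
  assumes X: "compact X" and \<mu>: "\<mu> \<in> signed_measures X" "\<nu> \<in> signed_measures X"
  shows "mutual_energy X \<mu> \<nu> = mutual_energy X \<nu> \<mu>"
proof (rule mutual_energy_discretization[OF X])
  fix n :: "nat \<Rightarrow> nat" and x :: "nat \<Rightarrow> nat \<Rightarrow> 'a" and A :: "nat \<Rightarrow> nat \<Rightarrow> 'a set"
  let ?L = "\<lambda>\<mu> \<nu> k. \<Sum>i<n k. \<Sum>j<n k. \<mu> (A k i) * \<nu> (A k j) * dist (x k i) (x k j)"
  assume L: "\<And>\<mu> \<nu>. \<mu> \<in> signed_measures X \<Longrightarrow> \<nu> \<in> signed_measures X \<Longrightarrow>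
      ?L \<mu> \<nu> \<longlonglongrightarrow> mutual_energy X \<mu> \<nu>"
  have "?L \<mu> \<nu> k = ?L \<nu> \<mu> k" for k
    by (subst sum.swap) (intro sum.cong refl, simp add: dist_commute)
  then show ?thesis using LIMSEQ_unique[OF L[OF \<mu>]] L[OF \<mu>(2,1)] by presburger
qed

lemma mutual_energy_sum:
  fixes X :: "'a::metric_space set"
  assumes X: "compact X"
    and \<mu>: "\<And>i. i \<in> I \<Longrightarrow> \<mu> i \<in> signed_measures X" and \<nu>: "\<And>j. j \<in> J \<Longrightarrow> \<nu> j \<in> signed_measures X"
  shows "mutual_energy X (\<lambda>A. \<Sum>i\<in>I. a i * \<mu> i A) (\<lambda>A. \<Sum>j\<in>J. b j * \<nu> j A)
    = (\<Sum>i\<in>I. \<Sum>j\<in>J. a i * b j * mutual_energy X (\<mu> i) (\<nu> j))"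
proof (rule mutual_energy_discretization[OF X])
  fix n :: "nat \<Rightarrow> nat" and x :: "nat \<Rightarrow> nat \<Rightarrow> 'a" and A :: "nat \<Rightarrow> nat \<Rightarrow> 'a set"
  let ?L = "\<lambda>\<mu> \<nu> k. \<Sum>i<n k. \<Sum>j<n k. \<mu> (A k i) * \<nu> (A k j) * dist (x k i) (x k j)"
  assume L: "\<And>\<mu> \<nu>. \<mu> \<in> signed_measures X \<Longrightarrow> \<nu> \<in> signed_measures X \<Longrightarrow>
      ?L \<mu> \<nu> \<longlonglongrightarrow> mutual_energy X \<mu> \<nu>"
  have "?L (\<lambda>A. \<Sum>i\<in>I. a i * \<mu> i A) (\<lambda>A. \<Sum>j\<in>J. b j * \<nu> j A) k
      = (\<Sum>i\<in>I. \<Sum>j\<in>J. a i * b j * ?L (\<mu> i) (\<nu> j) k)" for k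
  proof -
    \<comment> \<open>After expanding the product, four exchanges of adjacent sums carry the order
      \<open>p, q, i, j\<close> to \<open>i, j, p, q\<close>.\<close>
    have "?L (\<lambda>A. \<Sum>i\<in>I. a i * \<mu> i A) (\<lambda>A. \<Sum>j\<in>J. b j * \<nu> j A) k
      = (\<Sum>p<n k. \<Sum>q<n k. \<Sum>i\<in>I. \<Sum>j\<in>J. a i * b j * (\<mu> i (A k p) * \<nu> j (A k q) * dist (x k p) (x k q)))"
      by (simp only: sum_product, simp only: sum_distrib_right) (simp add: mult_ac)
    also have "\<dots> = (\<Sum>p<n k. \<Sum>i\<in>I. \<Sum>q<n k. \<Sum>j\<in>J. a i * b j * (\<mu> i (A k p) * \<nu> j (A k q) * dist (x k p) (x k q)))"
      by (intro sum.cong refl sum.swap)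
    also have "\<dots> = (\<Sum>i\<in>I. \<Sum>p<n k. \<Sum>q<n k. \<Sum>j\<in>J. a i * b j * (\<mu> i (A k p) * \<nu> j (A k q) * dist (x k p) (x k q)))"
      by (rule sum.swap)
    also have "\<dots> = (\<Sum>i\<in>I. \<Sum>p<n k. \<Sum>j\<in>J. \<Sum>q<n k. a i * b j * (\<mu> i (A k p) * \<nu> j (A k q) * dist (x k p) (x k q)))"
      by (intro sum.cong refl sum.swap)
    also have "\<dots> = (\<Sum>i\<in>I. \<Sum>j\<in>J. \<Sum>p<n k. \<Sum>q<n k. a i * b j * (\<mu> i (A k p) * \<nu> j (A k q) * dist (x k p) (x k q)))"
      by (intro sum.cong refl sum.swap)
    finally show ?thesis by (simp add: sum_distrib_left)
  qed
  moreover have "(\<lambda>k. \<Sum>i\<in>I. \<Sum>j\<in>J. a i * b j * ?L (\<mu> i) (\<nu> j) k)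
      \<longlonglongrightarrow> (\<Sum>i\<in>I. \<Sum>j\<in>J. a i * b j * mutual_energy X (\<mu> i) (\<nu> j))"
    by (intro tendsto_sum tendsto_mult_left L \<mu> \<nu>)
  moreover have "?L (\<lambda>A. \<Sum>i\<in>I. a i * \<mu> i A) (\<lambda>A. \<Sum>j\<in>J. b j * \<nu> j A)
      \<longlonglongrightarrow> mutual_energy X (\<lambda>A. \<Sum>i\<in>I. a i * \<mu> i A) (\<lambda>A. \<Sum>j\<in>J. b j * \<nu> j A)"
    by (intro L signed_measures_sum \<mu> \<nu>)
  ultimately show ?thesis by (simp only: LIMSEQ_unique)
qed

lemma signed_measures_lincomb:
  assumes "\<mu> \<in> signed_measures X" "\<nu> \<in> signed_measures X"
  shows "(\<lambda>A. s * \<mu> A + t * \<nu> A) \<in> signed_measures X"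
  \<comment> \<open>A combination of two measures is a sum indexed by the two booleans.\<close>
  using signed_measures_sum[of UNIV "\<lambda>b. if b then \<mu> else \<nu>" X "\<lambda>b. if b then s else t"] assms
  by (simp add: UNIV_bool add.commute)

text \<open>Bilinearity over the boolean index set yields four terms; symmetry merges the two mixed
  ones. All later arguments treat the energy as this quadratic form in \<open>s\<close> and
  \<open>t\<close>.\<close>

lemma energy_lincomb:
  fixes X :: "'a::metric_space set"
  assumes X: "compact X" and \<mu>: "\<mu> \<in> signed_measures X" and \<nu>: "\<nu> \<in> signed_measures X"
  shows "energy X (\<lambda>A. s * \<mu> A + t * \<nu> A)
    = s\<^sup>2 * energy X \<mu> + 2 * s * t * mutual_energy X \<mu> \<nu> + t\<^sup>2 * energy X \<nu>"
  using mutual_energy_sum[of X UNIV "\<lambda>b. if b then \<mu> else \<nu>" UNIV "\<lambda>b. if b then \<mu> else \<nu>"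
      "\<lambda>b. if b then s else t" "\<lambda>b. if b then s else t"]
    mutual_energy_commute[OF X \<mu> \<nu>] X \<mu> \<nu>
  by (simp add: UNIV_bool algebra_simps power2_eq_square)

section \<open>Point masses\<close>

text \<open>Taking the set function of \<open>return\<close> makes the point mass a probability
  measure of the library, so \<open>signed_integral_measure\<close> reduces integrals against it to
  evaluation.\<close>

definition dirac :: "'a::topological_space set \<Rightarrow> 'a \<Rightarrow> 'a set \<Rightarrow> real" where
  "dirac X x = measure (return (borel_on X) x)"

lemma dirac_in_probability_measures: "x \<in> X \<Longrightarrow> dirac X x \<in> probability_measures X"
  unfolding probability_measures_def dirac_def
  by (auto intro!: prob_space_return simp: space_restrict_space)

lemma dirac_in_signed_measures1: "x \<in> X \<Longrightarrow> dirac X x \<in> signed_measures1 X"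
  using dirac_in_probability_measures by (auto simp: probability_measures_eq)

lemma dirac_in_signed_measures: "x \<in> X \<Longrightarrow> dirac X x \<in> signed_measures X"
  using dirac_in_signed_measures1 by (auto simp: signed_measures1_def)

lemma signed_integral_dirac:
  assumes "x \<in> X" "f \<in> borel_measurable (borel_on X)"
  shows "signed_integral (borel_on X) (dirac X x) f = f x"
proof -
  interpret prob_space "return (borel_on X) x"
    using assms by (intro prob_space_return) (simp add: space_restrict_space)
  show ?thesis
    unfolding dirac_def using assms
    by (subst signed_integral_measure)
      (auto simp: integral_return space_restrict_space finite_measure_axioms)
qed

lemma mutual_energy_dirac:
  assumes "x \<in> X" "y \<in> X"
  shows "mutual_energy X (dirac X x) (dirac X y) = dist x y"
proof -
  have m: "(\<lambda>x. dist x y) \<in> borel_measurable (borel_on X)" "(\<lambda>y. dist x y) \<in> borel_measurable (borel_on X)" for x y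
    by (intro borel_measurable_continuous_on_restrict continuous_intros)+
  then show ?thesis using assms by (simp add: mutual_energy_def signed_integral_dirac)
qed

section \<open>The quasihypermetric property\<close>

text \<open>A bijection from \<open>{1..card I}\<close> carries the defining inequality over to any
  finite index set, such as the \<open>{..<n k}\<close> of the discretization.\<close>

lemma quasihypermetricD:
  assumes "quasihypermetric X" "finite I" "(\<Sum>i\<in>I. \<alpha> i) = 0" "\<And>i. i \<in> I \<Longrightarrow> x i \<in> X"
  shows "(\<Sum>i\<in>I. \<Sum>j\<in>I. \<alpha> i * \<alpha> j * dist (x i) (x j)) \<le> 0"
proof -
  obtain h where h: "bij_betw h {1..card I} I"
    using ex_bij_betw_nat_finite_1[OF \<open>finite I\<close>] by blast
  have re: "(\<Sum>i=1..card I. g (h i)) = (\<Sum>i\<in>I. g i)" for g :: "_ \<Rightarrow> real"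
    by (rule sum.reindex_bij_betw[OF h])
  have "(\<Sum>i=1..card I. \<alpha> (h i)) = 0" by (simp only: re assms(3))
  moreover have "\<forall>i\<in>{1..card I}. x (h i) \<in> X"
    using bij_betwE[OF h] assms(4) by blast
  ultimately have "(\<Sum>i=1..card I. \<Sum>j=1..card I. \<alpha> (h i) * \<alpha> (h j) * dist (x (h i)) (x (h j))) \<le> 0"
    using assms(1)[unfolded quasihypermetric_def, THEN spec[of _ "card I"],
        THEN spec[of _ "\<lambda>i. \<alpha> (h i)"], THEN spec[of _ "\<lambda>i. x (h i)"]] by blast
  also have "(\<Sum>i=1..card I. \<Sum>j=1..card I. \<alpha> (h i) * \<alpha> (h j) * dist (x (h i)) (x (h j)))
      = (\<Sum>i=1..card I. \<Sum>j\<in>I. \<alpha> (h i) * \<alpha> j * dist (x (h i)) (x j))"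
    by (intro sum.cong refl re)
  also have "\<dots> = (\<Sum>i\<in>I. \<Sum>j\<in>I. \<alpha> i * \<alpha> j * dist (x i) (x j))" by (rule re)
  finally show ?thesis .
qed

text \<open>The weights \<open>\<mu> (A k i)\<close> sum to \<open>\<mu> X = 0\<close>, so every
  discretized energy is nonpositive, and so is the limit.\<close>

lemma quasihypermetric_imp_energy_nonpos:
  assumes X: "compact X" and "quasihypermetric X" and \<mu>: "\<mu> \<in> signed_measures X" "\<mu> X = 0"
  shows "energy X \<mu> \<le> 0"
proof (rule mutual_energy_discretization[OF X])
  fix n :: "nat \<Rightarrow> nat" and x :: "nat \<Rightarrow> nat \<Rightarrow> 'a" and A :: "nat \<Rightarrow> nat \<Rightarrow> 'a set"
  assume "\<And>k i. i < n k \<Longrightarrow> x k i \<in> X"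
    and "\<And>\<mu> k. \<mu> \<in> signed_measures X \<Longrightarrow> (\<Sum>i<n k. \<mu> (A k i)) = \<mu> X"
  then have "(\<Sum>i<n k. \<Sum>j<n k. \<mu> (A k i) * \<mu> (A k j) * dist (x k i) (x k j)) \<le> 0" for k
    using \<mu> by (intro quasihypermetricD[OF assms(2)]) simp_all
  moreover assume L: "\<And>\<mu> \<nu>. \<mu> \<in> signed_measures X \<Longrightarrow> \<nu> \<in> signed_measures X \<Longrightarrow>
      (\<lambda>k. \<Sum>i<n k. \<Sum>j<n k. \<mu> (A k i) * \<nu> (A k j) * dist (x k i) (x k j))
        \<longlonglongrightarrow> mutual_energy X \<mu> \<nu>"
  ultimately show ?thesis
    using LIMSEQ_le_const2[OF L[OF \<mu>(1) \<mu>(1)], of 0] by blast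
qed

section \<open>From two lists of points to real weights\<close>

definition cross_distance_ineq :: "'a::metric_space set \<Rightarrow> bool" where
  "cross_distance_ineq X \<longleftrightarrow> (\<forall>(n::nat) (x::nat \<Rightarrow> 'a) (y::nat \<Rightarrow> 'a).
    (\<forall>i\<in>{1..n}. x i \<in> X) \<longrightarrow> (\<forall>i\<in>{1..n}. y i \<in> X) \<longrightarrow>
    (\<Sum>i=1..n. \<Sum>j=1..n. dist (x i) (x j)) + (\<Sum>i=1..n. \<Sum>j=1..n. dist (y i) (y j))
      \<le> 2 * (\<Sum>i=1..n. \<Sum>j=1..n. dist (x i) (y j)))"

text \<open>The two lists are re-indexed by arbitrary finite sets of equal size. As \<open>u\<close>
  and \<open>v\<close> need not be injective, points may be repeated.\<close>

lemma cross_distance_ineqD: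
  fixes X :: "'a::metric_space set"
  assumes X: "cross_distance_ineq X" and ST: "finite S" "finite T" "card S = card T"
    and u: "\<And>s. s \<in> S \<Longrightarrow> u s \<in> X" and v: "\<And>t. t \<in> T \<Longrightarrow> v t \<in> X"
  shows "(\<Sum>i\<in>S. \<Sum>j\<in>S. dist (u i) (u j)) + (\<Sum>i\<in>T. \<Sum>j\<in>T. dist (v i) (v j))
    \<le> 2 * (\<Sum>i\<in>S. \<Sum>j\<in>T. dist (u i) (v j))"
proof -
  obtain g h where g: "bij_betw g {1..card S} S" and h: "bij_betw h {1..card S} T"
    using ex_bij_betw_nat_finite_1[OF ST(1)] ex_bij_betw_nat_finite_1[OF ST(2)] ST(3) by auto
  have re: "(\<Sum>i=1..card S. \<Sum>j=1..card S. f (k i) (l j)) = (\<Sum>i\<in>K. \<Sum>j\<in>L. f i j)"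
    if k: "bij_betw k {1..card S} K" and l: "bij_betw l {1..card S} L"
    for f :: "_ \<Rightarrow> _ \<Rightarrow> real" and k l K L
    by (simp only: sum.reindex_bij_betw[OF l] sum.reindex_bij_betw[OF k, of "\<lambda>i. \<Sum>j\<in>L. f i j"])
  have "\<forall>i\<in>{1..card S}. u (g i) \<in> X" "\<forall>i\<in>{1..card S}. v (h i) \<in> X"
    using bij_betwE[OF g] bij_betwE[OF h] u v by blast+
  then have "(\<Sum>i=1..card S. \<Sum>j=1..card S. dist (u (g i)) (u (g j)))
      + (\<Sum>i=1..card S. \<Sum>j=1..card S. dist (v (h i)) (v (h j)))
      \<le> 2 * (\<Sum>i=1..card S. \<Sum>j=1..card S. dist (u (g i)) (v (h j)))"
    using X[unfolded cross_distance_ineq_def, THEN spec[of _ "card S"],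
        THEN spec[of _ "\<lambda>i. u (g i)"], THEN spec[of _ "\<lambda>i. v (h i)"]] by blast
  then show ?thesis
    by (simp only: re[OF g g, of "\<lambda>a b. dist (u a) (u b)"] re[OF h h, of "\<lambda>a b. dist (v a) (v b)"]
        re[OF g h, of "\<lambda>a b. dist (u a) (v b)"])
qed

text \<open>Write \<open>m = p - q\<close> with positive part \<open>p\<close> and negative part
  \<open>q\<close>. Repeating \<open>x i\<close> in one list \<open>p i\<close> times and in the
  other \<open>q i\<close> times gives lists of equal length because \<open>m\<close> sums to 0, and
  the inequality for these lists is the claim.\<close>

lemma cross_distance_ineq_imp_int:
  fixes X :: "'a::metric_space set" and m :: "'i \<Rightarrow> int"
  assumes X: "cross_distance_ineq X" and I: "finite I" and m: "(\<Sum>i\<in>I. m i) = 0"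
    and x: "\<And>i. i \<in> I \<Longrightarrow> x i \<in> X"
  shows "(\<Sum>i\<in>I. \<Sum>j\<in>I. real_of_int (m i) * real_of_int (m j) * dist (x i) (x j)) \<le> 0"
proof -
  define p q where "p i = nat (m i)" and "q i = nat (- m i)" for i
  \<comment> \<open>\<open>S p\<close> consists of \<open>p i\<close> labelled copies of each
    \<open>i\<close>, so a sum over \<open>S p\<close> is a sum over \<open>I\<close> weighted by
    \<open>p\<close>.\<close>
  define S where "S p = (SIGMA i:I. {..<p i})" for p :: "'i \<Rightarrow> nat"
  define D where "D p q = (\<Sum>i\<in>I. \<Sum>j\<in>I. real (p i) * real (q j) * dist (x i) (x j))" for p q
  have m_eq: "m i = int (p i) - int (q i)" for i by (simp add: p_def q_def)
  have fin: "finite (S p)" for p using I by (simp add: S_def)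
  have sum_S: "(\<Sum>s\<in>S p. f (fst s)) = (\<Sum>i\<in>I. real (p i) * f i)" for p and f :: "'i \<Rightarrow> real"
  proof -
    have "(\<Sum>s\<in>S p. f (fst s)) = (\<Sum>(i,j)\<in>S p. f i)" by (simp add: case_prod_unfold)
    also have "\<dots> = (\<Sum>i\<in>I. \<Sum>j<p i. f i)"
      unfolding S_def using I by (subst sum.Sigma) auto
    finally show ?thesis by simp
  qed
  have D_S: "(\<Sum>s\<in>S p. \<Sum>t\<in>S q. dist (x (fst s)) (x (fst t))) = D p q" for p q
  proof -
    have "(\<Sum>s\<in>S p. \<Sum>t\<in>S q. dist (x (fst s)) (x (fst t)))
        = (\<Sum>s\<in>S p. \<Sum>j\<in>I. real (q j) * dist (x (fst s)) (x j))"
      by (intro sum.cong refl sum_S)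
    also have "\<dots> = (\<Sum>i\<in>I. real (p i) * (\<Sum>j\<in>I. real (q j) * dist (x i) (x j)))"
      by (rule sum_S)
    finally show ?thesis by (simp add: D_def sum_distrib_left mult.assoc)
  qed
  have "int (card (S p)) - int (card (S q)) = (\<Sum>i\<in>I. m i)"
    using I by (simp add: S_def m_eq sum_subtractf)
  then have card: "card (S p) = card (S q)" using m by simp
  have "(\<Sum>s\<in>S p. \<Sum>t\<in>S p. dist (x (fst s)) (x (fst t))) + (\<Sum>s\<in>S q. \<Sum>t\<in>S q. dist (x (fst s)) (x (fst t)))
     \<le> 2 * (\<Sum>s\<in>S p. \<Sum>t\<in>S q. dist (x (fst s)) (x (fst t)))"
    by (rule cross_distance_ineqD[OF X fin fin card]) (auto simp: S_def x)
  then have "D p p + D q q \<le> 2 * D p q" by (simp only: D_S)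
  moreover have "D q p = D p q"
    unfolding D_def by (subst sum.swap) (intro sum.cong refl, simp add: dist_commute)
  moreover have "(\<Sum>i\<in>I. \<Sum>j\<in>I. real_of_int (m i) * real_of_int (m j) * dist (x i) (x j))
      = D p p - D p q - D q p + D q q"
    unfolding D_def sum_subtractf[symmetric] sum.distrib[symmetric]
    by (intro sum.cong refl) (simp add: m_eq algebra_simps)
  ultimately show ?thesis by linarith
qed

lemma floor_multiple_LIMSEQ:
  "(\<lambda>k. real_of_int \<lfloor>real (Suc k) * a\<rfloor> / real (Suc k)) \<longlonglongrightarrow> a"
proof -
  have "\<bar>real_of_int \<lfloor>real (Suc k) * a\<rfloor> / real (Suc k) - a\<bar> \<le> inverse (real (Suc k))" for k
  proof -
    have "real_of_int \<lfloor>real (Suc k) * a\<rfloor> / real (Suc k) - a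
        = (real_of_int \<lfloor>real (Suc k) * a\<rfloor> - real (Suc k) * a) / real (Suc k)"
      by (simp add: diff_divide_distrib)
    moreover have "\<bar>real_of_int \<lfloor>real (Suc k) * a\<rfloor> - real (Suc k) * a\<bar> \<le> 1"
      by linarith
    ultimately show ?thesis
      by (simp only: abs_divide) (simp add: divide_simps)
  qed
  then have "(\<lambda>k. real_of_int \<lfloor>real (Suc k) * a\<rfloor> / real (Suc k) - a) \<longlonglongrightarrow> 0"
    by (intro Lim_null_comparison[OF _ LIMSEQ_inverse_real_of_nat] always_eventually)
      (simp only: real_norm_def, blast)
  then show ?thesis by (rule LIM_zero_cancel)
qed

text \<open>The real weights are limits of integer weights divided by \<open>Suc k\<close>. Rounding
  must keep the sum exactly 0, so one index absorbs the rounding errors of all others.\<close>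

lemma cross_distance_ineq_imp_quasihypermetric:
  fixes X :: "'a::metric_space set"
  assumes X: "cross_distance_ineq X"
  shows "quasihypermetric X"
  unfolding quasihypermetric_def
proof (intro allI impI)
  fix n :: nat and \<alpha> :: "nat \<Rightarrow> real" and x :: "nat \<Rightarrow> 'a"
  assume \<alpha>: "(\<Sum>i=1..n. \<alpha> i) = 0" and x: "\<forall>i\<in>{1..n}. x i \<in> X"
  show "(\<Sum>i=1..n. \<Sum>j=1..n. \<alpha> i * \<alpha> j * dist (x i) (x j)) \<le> 0"
  proof (cases "n = 0")
    case False
    let ?I = "{1..n}" and ?J = "{2..n}"
    have I: "?I = insert 1 ?J" using False by auto
    \<comment> \<open>Index 1 receives minus the sum of the other rounded weights; it exists because
      \<open>n\<close> is positive here.\<close>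
    define m where "m k i = (if i = 1 then - (\<Sum>j\<in>?J. \<lfloor>real (Suc k) * \<alpha> j\<rfloor>)
      else \<lfloor>real (Suc k) * \<alpha> i\<rfloor>)" for k i
    have "(\<Sum>i\<in>?I. m k i) = 0" for k
    proof -
      have "(\<Sum>i\<in>?J. m k i) = (\<Sum>j\<in>?J. \<lfloor>real (Suc k) * \<alpha> j\<rfloor>)"
        by (intro sum.cong) (auto simp: m_def)
      then show ?thesis unfolding I by (simp add: m_def)
    qed
    then have le: "(\<Sum>i\<in>?I. \<Sum>j\<in>?I. real_of_int (m k i) * real_of_int (m k j) * dist (x i) (x j)) \<le> 0" for k
      using x by (intro cross_distance_ineq_imp_int[OF X]) auto
    \<comment> \<open>The form is homogeneous of degree 2, so rescaling the weights keeps its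
      sign.\<close>
    have "(\<Sum>i\<in>?I. \<Sum>j\<in>?I. (m k i / real (Suc k)) * (m k j / real (Suc k)) * dist (x i) (x j)) \<le> 0" for k
    proof -
      have "(\<Sum>i\<in>?I. \<Sum>j\<in>?I. (m k i / real (Suc k)) * (m k j / real (Suc k)) * dist (x i) (x j))
        = (\<Sum>i\<in>?I. \<Sum>j\<in>?I. real_of_int (m k i) * real_of_int (m k j) * dist (x i) (x j)) / (real (Suc k))\<^sup>2"
        by (simp only: sum_divide_distrib) (simp add: power2_eq_square)
      then show ?thesis using le[of k] by (simp only: divide_nonpos_nonneg zero_le_power2)
    qed
    moreover have lim: "(\<lambda>k. m k i / real (Suc k)) \<longlonglongrightarrow> \<alpha> i" if "i \<in> ?I" for i
    proof (cases "i = 1")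
      case True
      \<comment> \<open>The correcting weight also converges to the right value, since the
        \<open>\<alpha> i\<close> sum to 0.\<close>
      have "(\<lambda>k. - (\<Sum>j\<in>?J. real_of_int \<lfloor>real (Suc k) * \<alpha> j\<rfloor> / real (Suc k))) \<longlonglongrightarrow> - (\<Sum>j\<in>?J. \<alpha> j)"
        by (intro tendsto_minus tendsto_sum floor_multiple_LIMSEQ)
      moreover have "- (\<Sum>j\<in>?J. \<alpha> j) = \<alpha> 1"
        using \<alpha> unfolding I by simp
      moreover have "m k i / real (Suc k) = - (\<Sum>j\<in>?J. real_of_int \<lfloor>real (Suc k) * \<alpha> j\<rfloor> / real (Suc k))" for k
        using True by (simp add: m_def sum_divide_distrib[symmetric] del: of_nat_Suc)
      ultimately show ?thesis using True by simp
    next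
      case False
      then show ?thesis using floor_multiple_LIMSEQ[of "\<alpha> i"] by (simp only: m_def if_False)
    qed
    have "(\<lambda>k. \<Sum>i\<in>?I. \<Sum>j\<in>?I. (m k i / real (Suc k)) * (m k j / real (Suc k)) * dist (x i) (x j))
        \<longlonglongrightarrow> (\<Sum>i\<in>?I. \<Sum>j\<in>?I. \<alpha> i * \<alpha> j * dist (x i) (x j))"
      by (intro tendsto_sum tendsto_mult tendsto_const lim)
    ultimately show ?thesis by (intro LIMSEQ_le_const2) blast+
  qed simp
qed

text \<open>For the uniform measures on the two lists, counted with multiplicity, all three energies
  are the corresponding double sums divided by the square of \<open>n\<close>. The factor cancels
  for positive \<open>n\<close>, and for \<open>n = 0\<close> all sums are empty.\<close>

lemma probability_energy_imp_cross_distance_ineq: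
  fixes X :: "'a::metric_space set"
  assumes X: "compact X"
    and le: "\<And>\<mu> \<nu>. \<mu> \<in> probability_measures X \<Longrightarrow> \<nu> \<in> probability_measures X \<Longrightarrow>
      energy X \<mu> + energy X \<nu> \<le> 2 * mutual_energy X \<mu> \<nu>"
  shows "cross_distance_ineq X"
  unfolding cross_distance_ineq_def
proof (intro allI impI)
  fix n :: nat and x y :: "nat \<Rightarrow> 'a"
  assume x: "\<forall>i\<in>{1..n}. x i \<in> X" and y: "\<forall>i\<in>{1..n}. y i \<in> X"
  show "(\<Sum>i=1..n. \<Sum>j=1..n. dist (x i) (x j)) + (\<Sum>i=1..n. \<Sum>j=1..n. dist (y i) (y j))
      \<le> 2 * (\<Sum>i=1..n. \<Sum>j=1..n. dist (x i) (y j))"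
  proof (cases "n = 0")
    case False
    define P where "P x A = (\<Sum>i=1..n. (1 / real n) * dirac X (x i) A)" for x :: "nat \<Rightarrow> 'a" and A
    have P: "P x \<in> probability_measures X" if "\<forall>i\<in>{1..n}. x i \<in> X" for x
    proof -
      have dirac: "dirac X (x i) \<in> signed_measures X" "dirac X (x i) X = 1" "0 \<le> dirac X (x i) A"
        if "i \<in> {1..n}" for i A
        using dirac_in_probability_measures[of "x i" X] that \<open>\<forall>i\<in>{1..n}. x i \<in> X\<close>
        by (auto simp: probability_measures_eq signed_measures1_def)
      have "P x \<in> signed_measures X"
        unfolding P_def[abs_def] by (rule signed_measures_sum) (rule dirac)
      moreover have "P x X = 1"
        using False by (simp add: P_def dirac)
      moreover have "0 \<le> P x A" for A
        unfolding P_def by (intro sum_nonneg mult_nonneg_nonneg dirac) simp_all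
      ultimately show ?thesis by (simp add: probability_measures_eq signed_measures1_def)
    qed
    have ME: "mutual_energy X (P x) (P y) = (1 / real n)\<^sup>2 * (\<Sum>i=1..n. \<Sum>j=1..n. dist (x i) (y j))"
      if xy: "\<forall>i\<in>{1..n}. x i \<in> X" "\<forall>i\<in>{1..n}. y i \<in> X" for x y
    proof -
      have "mutual_energy X (P x) (P y)
        = (\<Sum>i=1..n. \<Sum>j=1..n. (1 / real n) * (1 / real n) * mutual_energy X (dirac X (x i)) (dirac X (y j)))"
        unfolding P_def[abs_def] using xy
        by (intro mutual_energy_sum X dirac_in_signed_measures) blast+
      also have "\<dots> = (\<Sum>i=1..n. \<Sum>j=1..n. (1 / real n)\<^sup>2 * dist (x i) (y j))"
        using xy by (intro sum.cong refl) (simp add: mutual_energy_dirac power2_eq_square)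
      finally show ?thesis by (simp add: sum_distrib_left)
    qed
    have "(1 / real n)\<^sup>2 * ((\<Sum>i=1..n. \<Sum>j=1..n. dist (x i) (x j)) + (\<Sum>i=1..n. \<Sum>j=1..n. dist (y i) (y j)))
      \<le> (1 / real n)\<^sup>2 * (2 * (\<Sum>i=1..n. \<Sum>j=1..n. dist (x i) (y j)))"
      using le[OF P[OF x] P[OF y]]
      by (simp only: ME[OF x x] ME[OF y y] ME[OF x y] distrib_left mult.left_commute[of 2 "(1 / real n)\<^sup>2"])
    then show ?thesis using False by (subst (asm) mult_le_cancel_left_pos) simp_all
  qed simp
qed

text \<open>This is the discriminant criterion for a nonpositive binary quadratic form. The
  degenerate case \<open>a = 0\<close> has to force \<open>b = 0\<close>.\<close>

lemma nonpos_form_Cauchy_Schwarz: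
  fixes a b c :: real
  assumes "\<And>s t. s\<^sup>2 * a + 2 * s * t * b + t\<^sup>2 * c \<le> 0"
  shows "b\<^sup>2 \<le> a * c"
proof -
  have "a \<le> 0" using assms[of 1 0] by simp
  show ?thesis
  proof (cases "a = 0")
    case True
    have "b = 0"
    proof (rule ccontr)
      assume "b \<noteq> 0"
      \<comment> \<open>With \<open>a = 0\<close> and \<open>t = 1\<close> the form is
        \<open>2 * s * b + c\<close>; this choice of \<open>s\<close> gives it the value 1.\<close>
      then show False using assms[of "(1 - c) / (2 * b)" 1] True by (simp add: field_simps)
    qed
    then show ?thesis using True by simp
  next
    case False
    with \<open>a \<le> 0\<close> have "a < 0" by simp
    \<comment> \<open>The left-hand side is the value of the form at \<open>s = b\<close>,
      \<open>t = - a\<close>.\<close>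
    have "a * (a * c - b\<^sup>2) \<le> 0"
      using assms[of b "- a"] by (simp add: algebra_simps power2_eq_square)
    then show ?thesis using \<open>a < 0\<close> by (auto simp: mult_le_0_iff)
  qed
qed

section \<open>The cycle of implications among the eight conditions\<close>

theorem theorem3p2:
  fixes X :: "'a::metric_space set"
  assumes "compact X"
  shows
    "(quasihypermetric X \<longleftrightarrow>
        (\<forall>(n::nat) (x::nat \<Rightarrow> 'a) (y::nat \<Rightarrow> 'a).
          (\<forall>i\<in>{1..n}. x i \<in> X) \<longrightarrow> (\<forall>i\<in>{1..n}. y i \<in> X) \<longrightarrow>
          (\<Sum>i=1..n. \<Sum>j=1..n. dist (x i) (x j)) + (\<Sum>i=1..n. \<Sum>j=1..n. dist (y i) (y j))
            \<le> 2 * (\<Sum>i=1..n. \<Sum>j=1..n. dist (x i) (y j)))) \<and>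
     (quasihypermetric X \<longleftrightarrow> (\<forall>\<mu>\<in>signed_measures0 X. energy X \<mu> \<le> 0)) \<and>
     (quasihypermetric X \<longleftrightarrow>
        (\<forall>\<mu>\<in>signed_measures0 X. \<forall>\<nu>\<in>signed_measures0 X.
          (mutual_energy X \<mu> \<nu>)\<^sup>2 \<le> energy X \<mu> * energy X \<nu>)) \<and>
     (quasihypermetric X \<longleftrightarrow>
        (\<forall>\<mu>\<in>signed_measures1 X. \<forall>\<nu>\<in>signed_measures1 X.
          energy X \<mu> + energy X \<nu> \<le> 2 * mutual_energy X \<mu> \<nu>)) \<and>
     (quasihypermetric X \<longleftrightarrow>
        (\<forall>\<mu>\<in>probability_measures X. \<forall>\<nu>\<in>probability_measures X.
          energy X \<mu> + energy X \<nu> \<le> 2 * mutual_energy X \<mu> \<nu>)) \<and>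
     (quasihypermetric X \<longleftrightarrow>
        (\<forall>\<mu>\<in>signed_measures1 X. \<forall>\<nu>\<in>signed_measures1 X.
          1/2 * (energy X \<mu> + energy X \<nu>) \<le> energy X (\<lambda>A. 1/2 * (\<mu> A + \<nu> A)))) \<and>
     (quasihypermetric X \<longleftrightarrow>
        (\<forall>\<mu>\<in>probability_measures X. \<forall>\<nu>\<in>probability_measures X.
          1/2 * (energy X \<mu> + energy X \<nu>) \<le> energy X (\<lambda>A. 1/2 * (\<mu> A + \<nu> A))))"
    (is "(?c1 \<longleftrightarrow> ?c2) \<and> (_ \<longleftrightarrow> ?c3) \<and> (_ \<longleftrightarrow> ?c4) \<and> (_ \<longleftrightarrow> ?c5) \<and> (_ \<longleftrightarrow> ?c6) \<and>
      (_ \<longleftrightarrow> ?c7) \<and> (_ \<longleftrightarrow> ?c8)")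
proof -
  note X = \<open>compact X\<close>
  have sm0: "\<mu> \<in> signed_measures X" "\<mu> X = 0" if "\<mu> \<in> signed_measures0 X" for \<mu>
    using that by (auto simp: signed_measures0_def)
  have sm1: "\<mu> \<in> signed_measures X" "\<mu> X = 1" if "\<mu> \<in> signed_measures1 X" for \<mu>
    using that by (auto simp: signed_measures1_def)
  have pm: "\<mu> \<in> signed_measures1 X" if "\<mu> \<in> probability_measures X" for \<mu>
    using that by (simp add: probability_measures_eq)
  have c2: "?c2 = cross_distance_ineq X" by (simp only: cross_distance_ineq_def)
  have 13: "?c3" if "?c1"
    using quasihypermetric_imp_energy_nonpos[OF X that] sm0 by blast
  have 35: "?c5" if c3: ?c3
  proof (intro ballI)
    fix \<mu> \<nu> assume \<mu>: "\<mu> \<in> signed_measures1 X" and \<nu>: "\<nu> \<in> signed_measures1 X"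
    \<comment> \<open>The difference of the two measures is written with explicit coefficients so
      that \<open>energy_lincomb\<close> matches it syntactically.\<close>
    have "(\<lambda>A. 1 * \<mu> A + (-1) * \<nu> A) \<in> signed_measures0 X"
      unfolding signed_measures0_def
      using signed_measures_lincomb[OF sm1(1)[OF \<mu>] sm1(1)[OF \<nu>], of 1 "-1"] sm1(2)[OF \<mu>] sm1(2)[OF \<nu>]
      by simp
    with c3 have "energy X (\<lambda>A. 1 * \<mu> A + (-1) * \<nu> A) \<le> 0" by (rule bspec)
    then show "energy X \<mu> + energy X \<nu> \<le> 2 * mutual_energy X \<mu> \<nu>"
      unfolding energy_lincomb[OF X sm1(1)[OF \<mu>] sm1(1)[OF \<nu>]] by simp
  qed
  have 56: "?c6" if "?c5" using that pm by blast
  have 62: "?c2" if "?c6"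
    unfolding c2 by (rule probability_energy_imp_cross_distance_ineq[OF X]) (use that in blast)
  have 21: "?c1" if "?c2"
    using that unfolding c2 by (rule cross_distance_ineq_imp_quasihypermetric)
  have 34: "?c4" if c3: ?c3
  proof (intro ballI)
    fix \<mu> \<nu> assume \<mu>: "\<mu> \<in> signed_measures0 X" and \<nu>: "\<nu> \<in> signed_measures0 X"
    show "(mutual_energy X \<mu> \<nu>)\<^sup>2 \<le> energy X \<mu> * energy X \<nu>"
    proof (rule nonpos_form_Cauchy_Schwarz)
      fix s t :: real
      have "(\<lambda>A. s * \<mu> A + t * \<nu> A) \<in> signed_measures0 X"
        unfolding signed_measures0_def
        using signed_measures_lincomb[OF sm0(1)[OF \<mu>] sm0(1)[OF \<nu>]] sm0(2)[OF \<mu>] sm0(2)[OF \<nu>]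
        by simp
      with c3 have "energy X (\<lambda>A. s * \<mu> A + t * \<nu> A) \<le> 0" by (rule bspec)
      then show "s\<^sup>2 * energy X \<mu> + 2 * s * t * mutual_energy X \<mu> \<nu> + t\<^sup>2 * energy X \<nu> \<le> 0"
        unfolding energy_lincomb[OF X sm0(1)[OF \<mu>] sm0(1)[OF \<nu>]] .
    qed
  qed
  \<comment> \<open>The disjunction reflects a case split: two distinct points provide a measure of
    negative energy, whereas with at most one point all distances vanish and \<open>?c1\<close> is
    immediate.\<close>
  have 4: "?c1 \<or> ?c3" if c4: ?c4
  proof (cases "\<exists>x\<in>X. \<exists>y\<in>X. x \<noteq> y")
    case True
    then obtain x y where xy: "x \<in> X" "y \<in> X" "x \<noteq> y" by blast
    define \<delta> where "\<delta> A = 1 * dirac X x A + (-1) * dirac X y A" for A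
    have d: "dirac X x \<in> signed_measures1 X" "dirac X y \<in> signed_measures1 X"
      using xy by (auto intro: dirac_in_signed_measures1)
    have \<delta>: "\<delta> \<in> signed_measures0 X"
      unfolding signed_measures0_def \<delta>_def[abs_def]
      using signed_measures_lincomb[OF sm1(1)[OF d(1)] sm1(1)[OF d(2)], of 1 "-1"]
        sm1(2)[OF d(1)] sm1(2)[OF d(2)] by simp
    \<comment> \<open>Point masses have energy 0, so only the mixed term survives.\<close>
    have "energy X \<delta> = - 2 * dist x y"
      unfolding \<delta>_def[abs_def] energy_lincomb[OF X sm1(1)[OF d(1)] sm1(1)[OF d(2)]]
      using xy by (simp add: mutual_energy_dirac)
    then have neg: "energy X \<delta> < 0" using xy by simp
    have "energy X \<nu> \<le> 0" if "\<nu> \<in> signed_measures0 X" for \<nu>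
    proof -
      \<comment> \<open>The square on the left makes the product of the energies nonnegative, so
        \<open>energy X \<nu>\<close> cannot be positive next to the negative
        \<open>energy X \<delta>\<close>.\<close>
      have "(mutual_energy X \<delta> \<nu>)\<^sup>2 \<le> energy X \<delta> * energy X \<nu>" using c4 \<delta> that by blast
      then have "0 \<le> energy X \<delta> * energy X \<nu>" by (rule order_trans[OF zero_le_power2])
      then show ?thesis using neg by (simp add: zero_le_mult_iff)
    qed
    then show ?thesis by blast
  next
    case False
    have "?c1"
      unfolding quasihypermetric_def
    proof (intro allI impI)
      fix n :: nat and \<alpha> :: "nat \<Rightarrow> real" and x :: "nat \<Rightarrow> 'a"
      assume x: "\<forall>i\<in>{1..n}. x i \<in> X"
      have d: "dist (x i) (x j) = 0" if "i \<in> {1..n}" "j \<in> {1..n}" for i j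
      proof -
        have "x i = x j" using bspec[OF x that(1)] bspec[OF x that(2)] False by blast
        then show ?thesis by simp
      qed
      show "(\<Sum>i=1..n. \<Sum>j=1..n. \<alpha> i * \<alpha> j * dist (x i) (x j)) \<le> 0"
        by (intro sum_nonpos) (simp only: d mult_zero_right order_refl)
    qed
    then show ?thesis ..
  qed
  \<comment> \<open>Expanding the energy of the midpoint shows that midpoint concavity and the
    inequality with the mutual energy agree for each single pair, so the same equivalence serves
    \<open>?c7\<close> and \<open>?c8\<close>.\<close>
  have mid: "1/2 * (energy X \<mu> + energy X \<nu>) \<le> energy X (\<lambda>A. 1/2 * (\<mu> A + \<nu> A)) \<longleftrightarrow>
      energy X \<mu> + energy X \<nu> \<le> 2 * mutual_energy X \<mu> \<nu>"
    if "\<mu> \<in> signed_measures1 X" "\<nu> \<in> signed_measures1 X" for \<mu> \<nu>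
  proof -
    have e: "energy X (\<lambda>A. 1/2 * (\<mu> A + \<nu> A)) =
        1/4 * energy X \<mu> + 1/2 * mutual_energy X \<mu> \<nu> + 1/4 * energy X \<nu>"
      using energy_lincomb[OF X sm1(1)[OF that(1)] sm1(1)[OF that(2)], of "1/2" "1/2"]
      by (simp add: distrib_left power2_eq_square)
    have "1/2 * (a + b) \<le> 1/4 * a + 1/2 * c + 1/4 * b \<longleftrightarrow> a + b \<le> 2 * c" for a b c :: real
      by auto
    then show ?thesis unfolding e .
  qed
  have 75: "?c7 \<longleftrightarrow> ?c5" by (intro ball_cong refl mid)
  have 86: "?c8 \<longleftrightarrow> ?c6" by (intro ball_cong refl mid pm)
  \<comment> \<open>The implications form the cycle \<open>?c1\<close>, \<open>?c3\<close>,
    \<open>?c5\<close>, \<open>?c6\<close>, \<open>?c2\<close>, \<open>?c1\<close>.\<close>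
  have 1: "?c2 \<longleftrightarrow> ?c1" "?c3 \<longleftrightarrow> ?c1" "?c5 \<longleftrightarrow> ?c1" "?c6 \<longleftrightarrow> ?c1"
    using 13 35 56 62 21 by argo+
  have "?c4 \<longleftrightarrow> ?c1" using 4 34 1(2) by argo
  with 1 show ?thesis unfolding 75 86 by argo
qed

end
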